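(* The category of necklaces $\mathcal{N}ec$ is equivalent to the category defined as follows. The objects are pairs $(T,p)$ with $p\ge0$ and $\{0<p\}\subseteq T\subseteq[p]$. The morphisms $(T,p)\to(U,q)$ are morphisms $f:[p]\to[q]$ in $\mathbf{\Delta}_f$ such that $U\subseteq f(T)$, with compositions and identities defined as in $\mathbf{\Delta}_f$. Moreover, under this equivalence, the wedge $\vee$ corresponds to $$(T,p)\vee(U,q)=(T\cup(p+U),\,p+q),$$ where $p+U=\{p+u\mid u\in U\}$.
   Context: $\mathbf{\Delta}_f$ is the category with objects the posets $[n]=\{0,\dots,n\}$, $n\ge0$, and morphisms the order-preserving maps $f:[m]\to[n]$ with $f(0)=0$ and $f(m)=n$. For $p\ge 0$, $\{0<p\}$ denotes the subset $\{0,p\}$ of $[p]$ (equal to $\{0\}$ if $p=0$). $\mathrm{SSet}_{*,*}$ is the category of bipointed simplicial sets: objects $(K,a,b)$ with $K$ a simplicial set and $a,b\in K_0$; morphisms are simplicial maps preserving both distinguished points in order. The wedge of $(K,a,b)$ and $(L,c,d)$ is the bipointed simplicial set $K\vee L$ obtained from $K\amalg L$ by identifying $b$ and $c$, with distinguished points $(a,d)$; this is a monoidal product with unit $\Delta^0$. The simplex $\Delta^n$ is bipointed by $(0,n)$. A necklace is an iterated wedge $\Delta^{n_1}\vee\dots\vee\Delta^{n_k}$ with $k\ge0$ and $n_1,\dots,n_k>0$ (equal to $\Delta^0$ if $k=0$). $\mathcal{N}ec$ is the full subcategory of $\mathrm{SSet}_{*,*}$ spanned by all necklaces, which is monoidal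 under $\vee$. *)

theory Defs
  imports "HOL-Library.FuncSet" "HOL-Library.FSet"
begin

section \<open>Categories and equivalences\<close>

text \<open>Every arrow has a unique domain and codomain: the hom-sets are pairwise disjoint, and empty
  outside the objects.\<close>

record ('o, 'm) cat =
  Ob :: "'o set"
  Hom :: "'o \<Rightarrow> 'o \<Rightarrow> 'm set"
  ident :: "'o \<Rightarrow> 'm"
  cmp :: "'m \<Rightarrow> 'm \<Rightarrow> 'm" (infixr "\<cdot>\<index>" 55)

locale category =
  fixes C :: "('o, 'm, 'z) cat_scheme" (structure)
  assumes Hom_Ob: "f \<in> Hom C X Y \<Longrightarrow> X \<in> Ob C \<and> Y \<in> Ob C"
    and Hom_disjoint: "f \<in> Hom C X Y \<Longrightarrow> f \<in> Hom C X' Y' \<Longrightarrow> X = X' \<and> Y = Y'"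
    and ident_Hom: "X \<in> Ob C \<Longrightarrow> ident C X \<in> Hom C X X"
    and cmp_Hom: "f \<in> Hom C X Y \<Longrightarrow> g \<in> Hom C Y Z \<Longrightarrow> g \<cdot> f \<in> Hom C X Z"
    and ident_left: "f \<in> Hom C X Y \<Longrightarrow> ident C Y \<cdot> f = f"
    and ident_right: "f \<in> Hom C X Y \<Longrightarrow> f \<cdot> ident C X = f"
    and cmp_assoc: "f \<in> Hom C W X \<Longrightarrow> g \<in> Hom C X Y \<Longrightarrow> h \<in> Hom C Y Z
      \<Longrightarrow> (h \<cdot> g) \<cdot> f = h \<cdot> (g \<cdot> f)"

definition isos :: "('o, 'm, 'z) cat_scheme \<Rightarrow> 'o \<Rightarrow> 'o \<Rightarrow> 'm set" where
  "isos C X Y = {f \<in> Hom C X Y. \<exists>g \<in> Hom C Y X.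
     g \<cdot>\<^bsub>C\<^esub> f = ident C X \<and> f \<cdot>\<^bsub>C\<^esub> g = ident C Y}"

definition full_subcategory ::
    "('o, 'm, 'z) cat_scheme \<Rightarrow> ('o \<Rightarrow> bool) \<Rightarrow> ('o, 'm, 'z) cat_scheme" where
  "full_subcategory C P =
     C\<lparr>Ob := {X \<in> Ob C. P X}, Hom := (\<lambda>X Y. if P X \<and> P Y then Hom C X Y else {})\<rparr>"

record ('o, 'm, 'p, 'n) functr =
  onOb :: "'o \<Rightarrow> 'p"
  onHom :: "'m \<Rightarrow> 'n"

definition id_functor :: "('o, 'm, 'o, 'm) functr" where
  "id_functor = \<lparr>onOb = id, onHom = id\<rparr>"

definition comp_functor ::
    "('p, 'n, 'q, 'k) functr \<Rightarrow> ('o, 'm, 'p, 'n) functr \<Rightarrow> ('o, 'm, 'q, 'k) functr" where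
  "comp_functor G F = \<lparr>onOb = onOb G \<circ> onOb F, onHom = onHom G \<circ> onHom F\<rparr>"

locale is_functor = C: category C + D: category D
  for C :: "('o, 'm, 'z) cat_scheme" and D :: "('p, 'n, 'y) cat_scheme" +
  fixes F :: "('o, 'm, 'p, 'n) functr"
  assumes onHom_Hom: "f \<in> Hom C X Y \<Longrightarrow> onHom F f \<in> Hom D (onOb F X) (onOb F Y)"
    and onOb_Ob: "X \<in> Ob C \<Longrightarrow> onOb F X \<in> Ob D"
    and onHom_ident: "X \<in> Ob C \<Longrightarrow> onHom F (ident C X) = ident D (onOb F X)"
    and onHom_cmp: "f \<in> Hom C X Y \<Longrightarrow> g \<in> Hom C Y Z
      \<Longrightarrow> onHom F (g \<cdot>\<^bsub>C\<^esub> f) = onHom F g \<cdot>\<^bsub>D\<^esub> onHom F f"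

locale natural_isomorphism = F: is_functor C D F + G: is_functor C D G
  for C :: "('o, 'm, 'z) cat_scheme" and D :: "('p, 'n, 'y) cat_scheme" and F G +
  fixes \<eta> :: "'o \<Rightarrow> 'n"
  assumes component_iso: "X \<in> Ob C \<Longrightarrow> \<eta> X \<in> isos D (onOb F X) (onOb G X)"
    and natural: "f \<in> Hom C X Y \<Longrightarrow> onHom G f \<cdot>\<^bsub>D\<^esub> \<eta> X = \<eta> Y \<cdot>\<^bsub>D\<^esub> onHom F f"

definition equivalence_of_categories ::
    "('o, 'm, 'z) cat_scheme \<Rightarrow> ('p, 'n, 'y) cat_scheme \<Rightarrow> ('o, 'm, 'p, 'n) functr \<Rightarrow> bool" where
  "equivalence_of_categories C D F \<longleftrightarrow> is_functor C D F \<and>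
     (\<exists>G \<eta> \<epsilon>. is_functor D C G
        \<and> natural_isomorphism C C id_functor (comp_functor G F) \<eta>
        \<and> natural_isomorphism D D (comp_functor F G) id_functor \<epsilon>)"


section \<open>Monoidal categories and monoidal functors\<close>

record ('o, 'm) moncat = "('o, 'm) cat" +
  tensor :: "'o \<Rightarrow> 'o \<Rightarrow> 'o" (infixr "\<otimes>\<index>" 70)
  tensor_map :: "'m \<Rightarrow> 'm \<Rightarrow> 'm" (infixr "\<odot>\<index>" 70)
  tunit :: "'o"
  assoc :: "'o \<Rightarrow> 'o \<Rightarrow> 'o \<Rightarrow> 'm"
  lunit :: "'o \<Rightarrow> 'm"
  runit :: "'o \<Rightarrow> 'm"

locale monoidal_category = category C
  for C :: "('o, 'm, 'z) moncat_scheme" (structure) +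
  assumes tensor_Ob: "X \<in> Ob C \<Longrightarrow> Y \<in> Ob C \<Longrightarrow> X \<otimes> Y \<in> Ob C"
    and tunit_Ob: "tunit C \<in> Ob C"
    and tensor_map_Hom: "f \<in> Hom C X X' \<Longrightarrow> g \<in> Hom C Y Y'
      \<Longrightarrow> f \<odot> g \<in> Hom C (X \<otimes> Y) (X' \<otimes> Y')"
    and tensor_map_ident: "X \<in> Ob C \<Longrightarrow> Y \<in> Ob C
      \<Longrightarrow> ident C X \<odot> ident C Y = ident C (X \<otimes> Y)"
    and tensor_map_cmp: "f \<in> Hom C X X' \<Longrightarrow> f' \<in> Hom C X' X'' \<Longrightarrow> g \<in> Hom C Y Y' \<Longrightarrow> g' \<in> Hom C Y' Y''
      \<Longrightarrow> (f' \<cdot> f) \<odot> (g' \<cdot> g) = (f' \<odot> g') \<cdot> (f \<odot> g)"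
    and assoc_iso: "X \<in> Ob C \<Longrightarrow> Y \<in> Ob C \<Longrightarrow> Z \<in> Ob C
      \<Longrightarrow> assoc C X Y Z \<in> isos C ((X \<otimes> Y) \<otimes> Z) (X \<otimes> (Y \<otimes> Z))"
    and assoc_natural: "f \<in> Hom C X X' \<Longrightarrow> g \<in> Hom C Y Y' \<Longrightarrow> h \<in> Hom C Z Z'
      \<Longrightarrow> assoc C X' Y' Z' \<cdot> ((f \<odot> g) \<odot> h) = (f \<odot> (g \<odot> h)) \<cdot> assoc C X Y Z"
    and lunit_iso: "X \<in> Ob C \<Longrightarrow> lunit C X \<in> isos C (tunit C \<otimes> X) X"
    and lunit_natural: "f \<in> Hom C X Y
      \<Longrightarrow> lunit C Y \<cdot> (ident C (tunit C) \<odot> f) = f \<cdot> lunit C X"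
    and runit_iso: "X \<in> Ob C \<Longrightarrow> runit C X \<in> isos C (X \<otimes> tunit C) X"
    and runit_natural: "f \<in> Hom C X Y
      \<Longrightarrow> runit C Y \<cdot> (f \<odot> ident C (tunit C)) = f \<cdot> runit C X"
    and pentagon: "W \<in> Ob C \<Longrightarrow> X \<in> Ob C \<Longrightarrow> Y \<in> Ob C \<Longrightarrow> Z \<in> Ob C
      \<Longrightarrow> assoc C W X (Y \<otimes> Z) \<cdot> assoc C (W \<otimes> X) Y Z
        = (ident C W \<odot> assoc C X Y Z) \<cdot> (assoc C W (X \<otimes> Y) Z \<cdot> (assoc C W X Y \<odot> ident C Z))"
    and triangle: "X \<in> Ob C \<Longrightarrow> Y \<in> Ob C
      \<Longrightarrow> (ident C X \<odot> lunit C Y) \<cdot> assoc C X (tunit C) Y = runit C X \<odot> ident C Y"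

locale strong_monoidal_functor =
  F: is_functor C D F + C: monoidal_category C + D: monoidal_category D
  for C :: "('o, 'm, 'z) moncat_scheme" and D :: "('p, 'n, 'y) moncat_scheme" and F +
  fixes \<phi> :: "'o \<Rightarrow> 'o \<Rightarrow> 'n" and \<iota> :: 'n
  assumes phi_iso: "X \<in> Ob C \<Longrightarrow> Y \<in> Ob C
      \<Longrightarrow> \<phi> X Y \<in> isos D (onOb F X \<otimes>\<^bsub>D\<^esub> onOb F Y) (onOb F (X \<otimes>\<^bsub>C\<^esub> Y))"
    and phi_natural: "f \<in> Hom C X X' \<Longrightarrow> g \<in> Hom C Y Y'
      \<Longrightarrow> \<phi> X' Y' \<cdot>\<^bsub>D\<^esub> (onHom F f \<odot>\<^bsub>D\<^esub> onHom F g) = onHom F (f \<odot>\<^bsub>C\<^esub> g) \<cdot>\<^bsub>D\<^esub> \<phi> X Y"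
    and iota_iso: "\<iota> \<in> isos D (tunit D) (onOb F (tunit C))"
    and phi_assoc: "X \<in> Ob C \<Longrightarrow> Y \<in> Ob C \<Longrightarrow> Z \<in> Ob C
      \<Longrightarrow> onHom F (assoc C X Y Z) \<cdot>\<^bsub>D\<^esub> (\<phi> (X \<otimes>\<^bsub>C\<^esub> Y) Z \<cdot>\<^bsub>D\<^esub> (\<phi> X Y \<odot>\<^bsub>D\<^esub> ident D (onOb F Z)))
        = \<phi> X (Y \<otimes>\<^bsub>C\<^esub> Z) \<cdot>\<^bsub>D\<^esub> ((ident D (onOb F X) \<odot>\<^bsub>D\<^esub> \<phi> Y Z)
            \<cdot>\<^bsub>D\<^esub> assoc D (onOb F X) (onOb F Y) (onOb F Z))"
    and phi_lunit: "X \<in> Ob C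
      \<Longrightarrow> onHom F (lunit C X) \<cdot>\<^bsub>D\<^esub> (\<phi> (tunit C) X \<cdot>\<^bsub>D\<^esub> (\<iota> \<odot>\<^bsub>D\<^esub> ident D (onOb F X)))
        = lunit D (onOb F X)"
    and phi_runit: "X \<in> Ob C
      \<Longrightarrow> onHom F (runit C X) \<cdot>\<^bsub>D\<^esub> (\<phi> X (tunit C) \<cdot>\<^bsub>D\<^esub> (ident D (onOb F X) \<odot>\<^bsub>D\<^esub> \<iota>))
        = runit D (onOb F X)"


section \<open>Bipointed simplicial sets\<close>

text \<open>The order-preserving maps from \<open>[m] = {..m}\<close> to \<open>[n] = {..n}\<close>, made extensional so that
  equality of maps is equality of functions.\<close>

definition delta :: "nat \<Rightarrow> nat \<Rightarrow> (nat \<Rightarrow> nat) set" where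
  "delta m n = {\<theta> \<in> {..m} \<rightarrow>\<^sub>E {..n}. mono_on {..m} \<theta>}"

text \<open>\<open>act K m n \<theta>\<close> is the map from \<open>n\<close>-simplices to \<open>m\<close>-simplices induced by \<open>\<theta> : [m] \<rightarrow> [n]\<close>.
  Its values outside \<open>delta m n\<close> and \<open>simp K n\<close> are irrelevant; records differing only there are
  isomorphic.\<close>

record 'a bisset =
  simp :: "nat \<Rightarrow> 'a set"
  act :: "nat \<Rightarrow> nat \<Rightarrow> (nat \<Rightarrow> nat) \<Rightarrow> 'a \<Rightarrow> 'a"
  src :: 'a
  tgt :: 'a

locale bipointed_simplicial_set =
  fixes K :: "'a bisset"
  assumes act_simp: "\<theta> \<in> delta m n \<Longrightarrow> x \<in> simp K n \<Longrightarrow> act K m n \<theta> x \<in> simp K m"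
    and act_ident: "x \<in> simp K n \<Longrightarrow> act K n n (\<lambda>i\<in>{..n}. i) x = x"
    and act_compose: "\<theta> \<in> delta l m \<Longrightarrow> \<zeta> \<in> delta m n \<Longrightarrow> x \<in> simp K n
      \<Longrightarrow> act K l m \<theta> (act K m n \<zeta> x) = act K l n (compose {..l} \<zeta> \<theta>) x"
    and src_simp: "src K \<in> simp K 0"
    and tgt_simp: "tgt K \<in> simp K 0"

definition bipointed_maps :: "'a bisset \<Rightarrow> 'b bisset \<Rightarrow> (nat \<Rightarrow> 'a \<Rightarrow> 'b) set" where
  "bipointed_maps K L = {\<phi>.
     (\<forall>n. \<phi> n \<in> simp K n \<rightarrow>\<^sub>E simp L n)
     \<and> (\<forall>m n. \<forall>\<theta> \<in> delta m n. \<forall>x \<in> simp K n. \<phi> m (act K m n \<theta> x) = act L m n \<theta> (\<phi> n x))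
     \<and> \<phi> 0 (src K) = src L \<and> \<phi> 0 (tgt K) = tgt L}"

text \<open>All simplicial sets are taken with simplices in one type, which contains a copy of the
  arbitrary type \<open>'a\<close> and of the simplices of every \<open>\<Delta>\<^sup>n\<close>, and which is closed under binary
  coproducts and under the formation of finite equivalence classes, hence under wedges.\<close>

datatype 'a cell =
    Atom 'a
  | Mono (un_Mono: "nat \<Rightarrow> nat")
  | InL "'a cell"
  | InR "'a cell"
  | Cls (un_Cls: "'a cell fset")

definition std_simplex :: "nat \<Rightarrow> 'a cell bisset" where
  "std_simplex n = \<lparr>
     simp = (\<lambda>m. Mono ` delta m n),
     act = (\<lambda>k m \<theta> x. Mono (compose {..k} (un_Mono x) \<theta>)),
     src = Mono (\<lambda>i\<in>{..0}. 0),
     tgt = Mono (\<lambda>i\<in>{..0}. n)\<rparr>"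


section \<open>Wedges\<close>

text \<open>The \<open>n\<close>-simplex degenerate on a vertex.\<close>

definition degen :: "'a bisset \<Rightarrow> nat \<Rightarrow> 'a \<Rightarrow> 'a" where
  "degen K n v = act K n 0 (\<lambda>i\<in>{..n}. 0) v"

text \<open>The equivalence class of a simplex of the coproduct, for the simplicial equivalence relation
  generated by \<open>InL (tgt K) \<sim> InR (src L)\<close>. In degree \<open>n\<close> this relation identifies the degenerate
  \<open>n\<close>-simplices on these two vertices, and all other classes are singletons.\<close>

definition glue :: "'a cell bisset \<Rightarrow> 'a cell bisset \<Rightarrow> nat \<Rightarrow> 'a cell \<Rightarrow> 'a cell" where
  "glue K L n z = Cls
     (let b = InL (degen K n (tgt K)); c = InR (degen L n (src L))
      in if z = b \<or> z = c then {|b, c|} else {|z|})"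

definition left_in :: "'a cell bisset \<Rightarrow> 'a cell bisset \<Rightarrow> nat \<Rightarrow> 'a cell \<Rightarrow> 'a cell" where
  "left_in K L n x = glue K L n (InL x)"

definition right_in :: "'a cell bisset \<Rightarrow> 'a cell bisset \<Rightarrow> nat \<Rightarrow> 'a cell \<Rightarrow> 'a cell" where
  "right_in K L n y = glue K L n (InR y)"

text \<open>The map out of a wedge (in one degree) induced by maps \<open>f\<close> and \<open>g\<close> out of the two summands,
  evaluated on a representative. It is only used where the result does not depend on the
  representative.\<close>

definition wedge_case :: "('a cell \<Rightarrow> 'b) \<Rightarrow> ('a cell \<Rightarrow> 'b) \<Rightarrow> 'a cell \<Rightarrow> 'b" where
  "wedge_case f g w = (case (SOME z. z |\<in>| un_Cls w) of InL x \<Rightarrow> f x | InR y \<Rightarrow> g y)"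

definition wedge :: "'a cell bisset \<Rightarrow> 'a cell bisset \<Rightarrow> 'a cell bisset" (infixr "\<or>\<^sub>w" 70) where
  "K \<or>\<^sub>w L = \<lparr>
     simp = (\<lambda>n. glue K L n ` (InL ` simp K n \<union> InR ` simp L n)),
     act = (\<lambda>m n \<theta>. wedge_case (\<lambda>x. left_in K L m (act K m n \<theta> x))
                                (\<lambda>y. right_in K L m (act L m n \<theta> y))),
     src = left_in K L 0 (src K),
     tgt = right_in K L 0 (tgt L)\<rparr>"


section \<open>The monoidal category of bipointed simplicial sets; necklaces\<close>

text \<open>An arrow is a triple consisting of its domain, the underlying map and its codomain.\<close>

type_synonym 'a bisset_arrow =
  "'a cell bisset \<times> (nat \<Rightarrow> 'a cell \<Rightarrow> 'a cell) \<times> 'a cell bisset"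

definition mk_arrow :: "'a cell bisset \<Rightarrow> (nat \<Rightarrow> 'a cell \<Rightarrow> 'a cell) \<Rightarrow> 'a cell bisset
    \<Rightarrow> 'a bisset_arrow" where
  "mk_arrow K \<phi> L = (K, (\<lambda>n. restrict (\<phi> n) (simp K n)), L)"

definition BSSet :: "('a cell bisset, 'a bisset_arrow) moncat" where
  "BSSet = \<lparr>
     Ob = Collect bipointed_simplicial_set,
     Hom = (\<lambda>K L. {(K, \<phi>, L) | \<phi>. bipointed_simplicial_set K \<and> bipointed_simplicial_set L
                                   \<and> \<phi> \<in> bipointed_maps K L}),
     ident = (\<lambda>K. mk_arrow K (\<lambda>n x. x) K),
     cmp = (\<lambda>(_, \<psi>, M) (K, \<phi>, _). mk_arrow K (\<lambda>n x. \<psi> n (\<phi> n x)) M),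
     tensor = wedge,
     tensor_map = (\<lambda>(K, \<phi>, K') (L, \<psi>, L').
       mk_arrow (K \<or>\<^sub>w L)
         (\<lambda>n. wedge_case (\<lambda>x. left_in K' L' n (\<phi> n x)) (\<lambda>y. right_in K' L' n (\<psi> n y)))
         (K' \<or>\<^sub>w L')),
     tunit = std_simplex 0,
     assoc = (\<lambda>K L M.
       mk_arrow ((K \<or>\<^sub>w L) \<or>\<^sub>w M)
         (\<lambda>n. wedge_case
                (wedge_case (left_in K (L \<or>\<^sub>w M) n)
                            (\<lambda>y. right_in K (L \<or>\<^sub>w M) n (left_in L M n y)))
                (\<lambda>z. right_in K (L \<or>\<^sub>w M) n (right_in L M n z)))
         (K \<or>\<^sub>w (L \<or>\<^sub>w M))),
     lunit = (\<lambda>K. mk_arrow (std_simplex 0 \<or>\<^sub>w K)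
                    (\<lambda>n. wedge_case (\<lambda>_. degen K n (src K)) (\<lambda>y. y)) K),
     runit = (\<lambda>K. mk_arrow (K \<or>\<^sub>w std_simplex 0)
                    (\<lambda>n. wedge_case (\<lambda>x. x) (\<lambda>_. degen K n (tgt K))) K)\<rparr>"

fun iterated_wedge :: "nat list \<Rightarrow> 'a cell bisset" where
  "iterated_wedge [] = std_simplex 0"
| "iterated_wedge [n] = std_simplex n"
| "iterated_wedge (n # m # ns) = std_simplex n \<or>\<^sub>w iterated_wedge (m # ns)"

text \<open>Iterated wedges are only determined up to isomorphism (different bracketings, units), so
  necklaces are closed under isomorphism; otherwise they would not be closed under wedges.\<close>

definition necklace :: "'a cell bisset \<Rightarrow> bool" where
  "necklace K \<longleftrightarrow>
     (\<exists>ns. (\<forall>n \<in> set ns. n > 0) \<and> isos BSSet (iterated_wedge ns) K \<noteq> {})"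

definition Nec :: "('a cell bisset, 'a bisset_arrow) moncat" where
  "Nec = full_subcategory BSSet necklace"


section \<open>The combinatorial category\<close>

definition delta_f :: "nat \<Rightarrow> nat \<Rightarrow> (nat \<Rightarrow> nat) set" where
  "delta_f p q = {f \<in> delta p q. f 0 = 0 \<and> f p = q}"

definition join_map :: "nat \<Rightarrow> nat \<Rightarrow> (nat \<Rightarrow> nat) \<Rightarrow> nat \<Rightarrow> (nat \<Rightarrow> nat) \<Rightarrow> (nat \<Rightarrow> nat)" where
  "join_map p p' f q g = (\<lambda>i\<in>{..p + q}. if i \<le> p then f i else p' + g (i - p))"

type_synonym joint_object = "nat set \<times> nat"
type_synonym joint_arrow = "joint_object \<times> (nat \<Rightarrow> nat) \<times> joint_object"

definition joint_wedge :: "joint_object \<Rightarrow> joint_object \<Rightarrow> joint_object" where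
  "joint_wedge = (\<lambda>(T, p) (U, q). (T \<union> {p + u | u. u \<in> U}, p + q))"

definition joint_ident :: "joint_object \<Rightarrow> joint_arrow" where
  "joint_ident X = (X, (\<lambda>i\<in>{..snd X}. i), X)"

text \<open>The wedge is strictly associative and unital here, so the structure maps are identities. On
  arrows it is the concatenation of maps.\<close>

definition JointOrd :: "(joint_object, joint_arrow) moncat" where
  "JointOrd = \<lparr>
     Ob = {(T, p). {0, p} \<subseteq> T \<and> T \<subseteq> {..p}},
     Hom = (\<lambda>(T, p) (U, q). {((T, p), f, (U, q)) | f.
              {0, p} \<subseteq> T \<and> T \<subseteq> {..p} \<and> {0, q} \<subseteq> U \<and> U \<subseteq> {..q}
              \<and> f \<in> delta_f p q \<and> U \<subseteq> f ` T}),
     ident = joint_ident,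
     cmp = (\<lambda>(_, g, Z) (X, f, _). (X, compose {..snd X} g f, Z)),
     tensor = joint_wedge,
     tensor_map = (\<lambda>(X, f, X') (Y, g, Y').
       (joint_wedge X Y, join_map (snd X) (snd X') f (snd Y) g, joint_wedge X' Y')),
     tunit = ({0}, 0),
     assoc = (\<lambda>X Y Z. joint_ident (joint_wedge X (joint_wedge Y Z))),
     lunit = joint_ident,
     runit = joint_ident\<rparr>"

end

theory Submission
  imports Defs
begin

text \<open>A simplex of a necklace is determined by its vertices, and the vertices are linearly ordered. So
  a bipointed simplicial set is a necklace with vertices \<open>{..p}\<close> and joints \<open>T\<close> iff its vertices carry
  labels for which taking the label sequence is, in every degree, a bijection onto the monotone
  sequences in \<open>{..p}\<close> whose ends are not separated by an element of \<open>T\<close>. Bipointed maps between labelled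
  objects then amount to vertex maps; testing them on edges, and on edges joining consecutive
  joints, shows that exactly the maps \<open>f\<close> with \<open>U \<subseteq> f(T)\<close> occur. This gives a fully faithful functor,
  surjective on objects, which takes wedges and the structure maps strictly to concatenations and
  identities; the monoidal axioms for necklaces can therefore be checked after applying it.\<close>

section \<open>Fully faithful functors\<close>

text \<open>A necklace is given only up to isomorphism, so its joints cannot be read off from a
  presentation as an iterated wedge. A labelling replaces the presentation: it identifies the
  simplicial set with a subobject of a simplex, and it can be carried along isomorphisms. It is also
  unique, because an order-preserving bijection of finite chains is the identity. So choosing joints
  and labels involves no real choice, and isomorphic necklaces get the same joints; this is why the
  functor can be strict. The inclusion \<open>U \<subseteq> f(T)\<close> arises as follows. If a
  joint u of the target is not the image of a joint, then some consecutive joints s < t satisfy f(s)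
  < u < f(t). The edge from s to t lies in one bead, but its image would cross u and so would not be
  a simplex. Conversely, if every u is some f(t) with t a joint, then a simplex on one side of t is
  sent to one side of u. The image of a joint need not be a joint, since f may carry several beads
  into one; hence an inclusion and not an equality.\<close>

lemma in_isosI:
  assumes "f \<in> Hom C X Y" "g \<in> Hom C Y X" "cmp C g f = ident C X" "cmp C f g = ident C Y"
  shows "f \<in> isos C X Y"
  using assms unfolding isos_def by blast

lemma (in category) ident_iso: "X \<in> Ob C \<Longrightarrow> ident C X \<in> isos C X X"
  by (rule in_isosI) (auto intro: ident_Hom ident_left)

locale fully_faithful_functor = is_functor C D F
  for C :: "('o, 'm, 'z) cat_scheme" and D :: "('p, 'n, 'y) cat_scheme" and F +
  assumes full: "X \<in> Ob C \<Longrightarrow> Y \<in> Ob C \<Longrightarrow> g \<in> Hom D (onOb F X) (onOb F Y)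
      \<Longrightarrow> \<exists>f \<in> Hom C X Y. onHom F f = g"
    and faithful: "f \<in> Hom C X Y \<Longrightarrow> f' \<in> Hom C X Y \<Longrightarrow> onHom F f = onHom F f' \<Longrightarrow> f = f'"
begin

text \<open>Fullness supplies a preimage of the inverse, and faithfulness pulls back the two inverse
  laws.\<close>

lemma reflects_isos:
  assumes f: "f \<in> Hom C X Y" and iso: "onHom F f \<in> isos D (onOb F X) (onOb F Y)"
  shows "f \<in> isos C X Y"
proof -
  have ob: "X \<in> Ob C" "Y \<in> Ob C" using C.Hom_Ob[OF f] by auto
  obtain h where h: "h \<in> Hom D (onOb F Y) (onOb F X)"
      "cmp D h (onHom F f) = ident D (onOb F X)" "cmp D (onHom F f) h = ident D (onOb F Y)"
    using iso unfolding isos_def by blast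
  obtain g where g: "g \<in> Hom C Y X" "onHom F g = h" using full[OF ob(2,1) h(1)] by blast
  show ?thesis
  proof (rule in_isosI[OF f g(1)])
    show "cmp C g f = ident C X"
      by (rule faithful[OF C.cmp_Hom[OF f g(1)] C.ident_Hom[OF ob(1)]])
        (simp add: onHom_cmp[OF f g(1)] onHom_ident ob g h)
    show "cmp C f g = ident C Y"
      by (rule faithful[OF C.cmp_Hom[OF g(1) f] C.ident_Hom[OF ob(2)]])
        (simp add: onHom_cmp[OF g(1) f] onHom_ident ob g h)
  qed
qed

text \<open>One chosen preimage per object extends to a quasi-inverse, since arrows between the
  chosen objects lift uniquely. Going from \<open>D\<close> to \<open>C\<close> and back is then the
  identity, so only the unit has to be constructed.\<close>

lemma equivalence_if_surjective:
  assumes surj: "\<And>Y. Y \<in> Ob D \<Longrightarrow> \<exists>X \<in> Ob C. onOb F X = Y"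
  shows "equivalence_of_categories C D F"
proof -
  obtain s where s: "\<And>Y. Y \<in> Ob D \<Longrightarrow> s Y \<in> Ob C \<and> onOb F (s Y) = Y"
    using surj by metis
  \<comment> \<open>The lift must be a function of the arrow alone. Disjointness of the hom-sets
    makes the endpoints recoverable from \<open>g\<close>; an arrow in no hom-set is covered
    vacuously.\<close>
  have "\<exists>f. \<forall>X Y. g \<in> Hom D X Y \<longrightarrow> f \<in> Hom C (s X) (s Y) \<and> onHom F f = g" for g
  proof (cases "\<exists>X Y. g \<in> Hom D X Y")
    case True
    then obtain X Y where g: "g \<in> Hom D X Y" by blast
    then have "X \<in> Ob D" "Y \<in> Ob D" using D.Hom_Ob by blast+
    then obtain f where "f \<in> Hom C (s X) (s Y)" "onHom F f = g"
      using full[of "s X" "s Y" g] s g by auto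
    then show ?thesis using D.Hom_disjoint[OF g] by blast
  qed simp
  then obtain lift where lift: "\<And>g X Y. g \<in> Hom D X Y \<Longrightarrow>
      lift g \<in> Hom C (s X) (s Y) \<and> onHom F (lift g) = g"
    by metis
  define G where "G = \<lparr>onOb = s, onHom = lift\<rparr>"
  have G: "is_functor D C G"
  proof (unfold_locales, goal_cases)
    case (1 f X Y) then show ?case using lift by (simp add: G_def)
  next
    case (2 X) then show ?case using s by (simp add: G_def)
  next
    case (3 X)
    then show ?case
      using faithful[OF conjunct1[OF lift[OF D.ident_Hom[OF 3]]] C.ident_Hom]
        s lift[OF D.ident_Hom] onHom_ident by (simp add: G_def)
  next
    case (4 f X Y g Z)
    have f: "lift f \<in> Hom C (s X) (s Y)" "onHom F (lift f) = f" using lift 4 by blast+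
    have g: "lift g \<in> Hom C (s Y) (s Z)" "onHom F (lift g) = g" using lift 4 by blast+
    have "lift (cmp D g f) = cmp C (lift g) (lift f)"
      by (rule faithful[OF conjunct1[OF lift[OF D.cmp_Hom[OF 4]]] C.cmp_Hom[OF f(1) g(1)]])
        (use lift[OF D.cmp_Hom[OF 4]] in \<open>simp add: onHom_cmp[OF f(1) g(1)] f g\<close>)
    then show ?case by (simp add: G_def)
  qed
  \<comment> \<open>An object and its chosen representative lie over the same object of
    \<open>D\<close>, so the identity there lifts to the component of the unit.\<close>
  have "\<exists>h. h \<in> Hom C X (s (onOb F X)) \<and> onHom F h = ident D (onOb F X)" if "X \<in> Ob C" for X
    using full[of X "s (onOb F X)" "ident D (onOb F X)"] s[OF onOb_Ob[OF that]] that
      D.ident_Hom[OF onOb_Ob[OF that]] by auto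
  then obtain \<eta> where \<eta>: "\<And>X. X \<in> Ob C \<Longrightarrow>
      \<eta> X \<in> Hom C X (s (onOb F X)) \<and> onHom F (\<eta> X) = ident D (onOb F X)"
    by metis
  interpret G: is_functor D C G by (rule G)
  have id_C: "is_functor C C id_functor"
    by unfold_locales (auto simp: id_functor_def)
  have id_D: "is_functor D D id_functor"
    by unfold_locales (auto simp: id_functor_def)
  have GF: "is_functor C C (comp_functor G F)"
    by unfold_locales
      (auto simp: comp_functor_def onOb_Ob G.onOb_Ob onHom_ident G.onHom_ident
        onHom_cmp[of _ _ _ _ _] intro: onHom_Hom G.onHom_Hom G.onHom_cmp)
  have FG: "is_functor D D (comp_functor F G)"
    by unfold_locales
      (auto simp: comp_functor_def onOb_Ob G.onOb_Ob onHom_ident G.onHom_ident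
        G.onHom_cmp[of _ _ _ _ _] intro: onHom_Hom G.onHom_Hom onHom_cmp)
  have nat_C: "natural_isomorphism C C id_functor (comp_functor G F) \<eta>"
  proof -
    have 1: "\<eta> X \<in> isos C X (s (onOb F X))" if X: "X \<in> Ob C" for X
      using reflects_isos[of "\<eta> X" X "s (onOb F X)"] \<eta>[OF X] s[OF onOb_Ob[OF X]]
        D.ident_iso[OF onOb_Ob[OF X]] by simp
    have 2: "cmp C (lift (onHom F f)) (\<eta> X) = cmp C (\<eta> Y) f" if f: "f \<in> Hom C X Y" for f X Y
    proof -
      have X: "X \<in> Ob C" and Y: "Y \<in> Ob C" using C.Hom_Ob[OF f] by auto
      note Ff = onHom_Hom[OF f]
      note l = conjunct1[OF lift[OF Ff]] and hX = conjunct1[OF \<eta>[OF X]] and hY = conjunct1[OF \<eta>[OF Y]]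
      show ?thesis
        by (rule faithful[OF C.cmp_Hom[OF hX l] C.cmp_Hom[OF f hY]])
          (simp add: onHom_cmp[OF hX l] onHom_cmp[OF f hY] lift[OF Ff] \<eta> X Y
            D.ident_left[OF Ff] D.ident_right[OF Ff])
    qed
    show ?thesis
      unfolding natural_isomorphism_def natural_isomorphism_axioms_def
      using id_C GF 1 2 by (simp add: id_functor_def comp_functor_def G_def)
  qed
  have nat_D: "natural_isomorphism D D (comp_functor F G) id_functor (ident D)"
    unfolding natural_isomorphism_def natural_isomorphism_axioms_def
    using FG id_D s D.ident_iso lift D.ident_left D.ident_right
    by (auto simp: id_functor_def comp_functor_def G_def)
  show ?thesis
    unfolding equivalence_of_categories_def using is_functor_axioms G nat_C nat_D by blast
qed

end

text \<open>The source is not assumed monoidal. Its structure maps are only required to have the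
  right endpoints and to be sent to those of \<open>D\<close>; their invertibility and all coherence
  equations are then reflected by the functor.\<close>

locale strict_monoidal_embedding = fully_faithful_functor C D F + D: monoidal_category D
  for C :: "('o, 'm, 'z) moncat_scheme" and D :: "('p, 'n, 'y) moncat_scheme" and F +
  assumes tensor_Ob: "X \<in> Ob C \<Longrightarrow> Y \<in> Ob C \<Longrightarrow> X \<otimes>\<^bsub>C\<^esub> Y \<in> Ob C"
    and tunit_Ob: "tunit C \<in> Ob C"
    and tensor_map_Hom: "f \<in> Hom C X X' \<Longrightarrow> g \<in> Hom C Y Y'
      \<Longrightarrow> f \<odot>\<^bsub>C\<^esub> g \<in> Hom C (X \<otimes>\<^bsub>C\<^esub> Y) (X' \<otimes>\<^bsub>C\<^esub> Y')"
    and assoc_Hom: "X \<in> Ob C \<Longrightarrow> Y \<in> Ob C \<Longrightarrow> Z \<in> Ob C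
      \<Longrightarrow> assoc C X Y Z \<in> Hom C ((X \<otimes>\<^bsub>C\<^esub> Y) \<otimes>\<^bsub>C\<^esub> Z) (X \<otimes>\<^bsub>C\<^esub> (Y \<otimes>\<^bsub>C\<^esub> Z))"
    and lunit_Hom: "X \<in> Ob C \<Longrightarrow> lunit C X \<in> Hom C (tunit C \<otimes>\<^bsub>C\<^esub> X) X"
    and runit_Hom: "X \<in> Ob C \<Longrightarrow> runit C X \<in> Hom C (X \<otimes>\<^bsub>C\<^esub> tunit C) X"
    and onOb_tensor: "X \<in> Ob C \<Longrightarrow> Y \<in> Ob C
      \<Longrightarrow> onOb F (X \<otimes>\<^bsub>C\<^esub> Y) = onOb F X \<otimes>\<^bsub>D\<^esub> onOb F Y"
    and onOb_tunit: "onOb F (tunit C) = tunit D"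
    and onHom_tensor: "f \<in> Hom C X X' \<Longrightarrow> g \<in> Hom C Y Y'
      \<Longrightarrow> onHom F (f \<odot>\<^bsub>C\<^esub> g) = onHom F f \<odot>\<^bsub>D\<^esub> onHom F g"
    and onHom_assoc: "X \<in> Ob C \<Longrightarrow> Y \<in> Ob C \<Longrightarrow> Z \<in> Ob C
      \<Longrightarrow> onHom F (assoc C X Y Z) = assoc D (onOb F X) (onOb F Y) (onOb F Z)"
    and onHom_lunit: "X \<in> Ob C \<Longrightarrow> onHom F (lunit C X) = lunit D (onOb F X)"
    and onHom_runit: "X \<in> Ob C \<Longrightarrow> onHom F (runit C X) = runit D (onOb F X)"
begin

lemma monoidal_category_source: "monoidal_category C"
proof (unfold_locales, goal_cases)
  case (1 X Y) then show ?case by (rule tensor_Ob)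
next
  case 2 show ?case by (rule tunit_Ob)
next
  case (3 f X X' g Y Y') then show ?case by (rule tensor_map_Hom)
next
  case (4 X Y)
  show ?case
    by (rule faithful[where X = "X \<otimes>\<^bsub>C\<^esub> Y" and Y = "X \<otimes>\<^bsub>C\<^esub> Y"])
      (use 4 in \<open>auto intro: tensor_map_Hom C.ident_Hom simp: onHom_tensor[OF C.ident_Hom C.ident_Hom] onHom_ident
        tensor_Ob onOb_tensor D.tensor_map_ident onOb_Ob\<close>)
next
  case (5 f X X' f' X'' g Y Y' g' Y'')
  note h = tensor_map_Hom[OF 5(1,3)] tensor_map_Hom[OF 5(2,4)] C.cmp_Hom[OF 5(1,2)] C.cmp_Hom[OF 5(3,4)]
  show ?case
    by (rule faithful[OF tensor_map_Hom[OF h(3,4)] C.cmp_Hom[OF h(1,2)]])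
      (simp add: onHom_tensor[OF h(3,4)] onHom_cmp[OF h(1,2)] onHom_cmp[OF 5(1,2)]
        onHom_cmp[OF 5(3,4)] onHom_tensor[OF 5(1,3)] onHom_tensor[OF 5(2,4)]
        D.tensor_map_cmp[OF onHom_Hom[OF 5(1)] onHom_Hom[OF 5(2)] onHom_Hom[OF 5(3)] onHom_Hom[OF 5(4)]])
next
  case (6 X Y Z)
  show ?case
    by (rule reflects_isos[OF assoc_Hom[OF 6]])
      (use D.assoc_iso 6 in \<open>simp add: onHom_assoc onOb_tensor tensor_Ob onOb_Ob\<close>)
next
  case (7 f X X' g Y Y' h Z Z')
  note ob = C.Hom_Ob[OF 7(1)] C.Hom_Ob[OF 7(2)] C.Hom_Ob[OF 7(3)]
  note h = tensor_map_Hom[OF tensor_map_Hom[OF 7(1,2)] 7(3)] tensor_map_Hom[OF 7(1) tensor_map_Hom[OF 7(2,3)]]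
  note a = assoc_Hom[of X Y Z] assoc_Hom[of X' Y' Z']
  have a': "assoc C X Y Z \<in> Hom C ((X \<otimes>\<^bsub>C\<^esub> Y) \<otimes>\<^bsub>C\<^esub> Z) (X \<otimes>\<^bsub>C\<^esub> (Y \<otimes>\<^bsub>C\<^esub> Z))"
    "assoc C X' Y' Z' \<in> Hom C ((X' \<otimes>\<^bsub>C\<^esub> Y') \<otimes>\<^bsub>C\<^esub> Z') (X' \<otimes>\<^bsub>C\<^esub> (Y' \<otimes>\<^bsub>C\<^esub> Z'))"
    using a ob by auto
  show ?case
    by (rule faithful[OF C.cmp_Hom[OF h(1) a'(2)] C.cmp_Hom[OF a'(1) h(2)]])
      (simp add: onHom_cmp[OF h(1) a'(2)] onHom_cmp[OF a'(1) h(2)] onHom_assoc ob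
        onHom_tensor[OF tensor_map_Hom[OF 7(1,2)] 7(3)] onHom_tensor[OF 7(1,2)]
        onHom_tensor[OF 7(1) tensor_map_Hom[OF 7(2,3)]] onHom_tensor[OF 7(2,3)]
        D.assoc_natural[OF onHom_Hom[OF 7(1)] onHom_Hom[OF 7(2)] onHom_Hom[OF 7(3)]])
next
  case (8 X)
  show ?case
    by (rule reflects_isos[OF lunit_Hom[OF 8]])
      (use D.lunit_iso 8 in \<open>simp add: onHom_lunit onOb_tensor onOb_tunit tunit_Ob onOb_Ob\<close>)
next
  case (9 f X Y)
  have ob: "X \<in> Ob C" "Y \<in> Ob C" using C.Hom_Ob[OF 9] by auto
  note t = tensor_map_Hom[OF C.ident_Hom[OF tunit_Ob] 9]
  show ?case
    by (rule faithful[OF C.cmp_Hom[OF t lunit_Hom[OF ob(2)]] C.cmp_Hom[OF lunit_Hom[OF ob(1)] 9]])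
      (use D.lunit_natural[OF onHom_Hom[OF 9]] in \<open>simp add: onHom_cmp[OF t lunit_Hom[OF ob(2)]]
        onHom_cmp[OF lunit_Hom[OF ob(1)] 9] onHom_lunit ob onHom_tensor[OF C.ident_Hom[OF tunit_Ob] 9]
        onHom_ident tunit_Ob onOb_tunit\<close>)
next
  case (10 X)
  show ?case
    by (rule reflects_isos[OF runit_Hom[OF 10]])
      (use D.runit_iso 10 in \<open>simp add: onHom_runit onOb_tensor onOb_tunit tunit_Ob onOb_Ob\<close>)
next
  case (11 f X Y)
  have ob: "X \<in> Ob C" "Y \<in> Ob C" using C.Hom_Ob[OF 11] by auto
  note t = tensor_map_Hom[OF 11 C.ident_Hom[OF tunit_Ob]]
  show ?case
    by (rule faithful[OF C.cmp_Hom[OF t runit_Hom[OF ob(2)]] C.cmp_Hom[OF runit_Hom[OF ob(1)] 11]])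
      (use D.runit_natural[OF onHom_Hom[OF 11]] in \<open>simp add: onHom_cmp[OF t runit_Hom[OF ob(2)]]
        onHom_cmp[OF runit_Hom[OF ob(1)] 11] onHom_runit ob onHom_tensor[OF 11 C.ident_Hom[OF tunit_Ob]]
        onHom_ident tunit_Ob onOb_tunit\<close>)
next
  case (12 W X Y Z)
  note i = C.ident_Hom[OF 12(1)] C.ident_Hom[OF 12(4)]
  note XY = tensor_Ob[OF 12(2,3)] and WX = tensor_Ob[OF 12(1,2)] and YZ = tensor_Ob[OF 12(3,4)]
  note a1 = assoc_Hom[OF WX 12(3,4)] and a2 = assoc_Hom[OF 12(1,2) YZ]
    and b1 = tensor_map_Hom[OF assoc_Hom[OF 12(1-3)] i(2)] and b2 = assoc_Hom[OF 12(1) XY 12(4)]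
    and b3 = tensor_map_Hom[OF i(1) assoc_Hom[OF 12(2-4)]]
  note b12 = C.cmp_Hom[OF b1 b2]
  show ?case
    by (rule faithful[OF C.cmp_Hom[OF a1 a2] C.cmp_Hom[OF b12 b3]])
      (use D.pentagon 12 in \<open>simp add: onHom_cmp[OF a1 a2] onHom_cmp[OF b12 b3] onHom_cmp[OF b1 b2]
        onHom_tensor[OF assoc_Hom[OF 12(1-3)] i(2)] onHom_tensor[OF i(1) assoc_Hom[OF 12(2-4)]]
        onHom_assoc onHom_ident onOb_tensor tensor_Ob onOb_Ob\<close>)
next
  case (13 X Y)
  note i = C.ident_Hom[OF 13(1)] C.ident_Hom[OF 13(2)]
  note a = assoc_Hom[OF 13(1) tunit_Ob 13(2)] and b = tensor_map_Hom[OF i(1) lunit_Hom[OF 13(2)]]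
    and c = tensor_map_Hom[OF runit_Hom[OF 13(1)] i(2)]
  show ?case
    by (rule faithful[OF C.cmp_Hom[OF a b] c])
      (use D.triangle 13 in \<open>simp add: onHom_cmp[OF a b] onHom_tensor[OF i(1) lunit_Hom[OF 13(2)]]
        onHom_tensor[OF runit_Hom[OF 13(1)] i(2)] onHom_assoc onHom_lunit onHom_runit onHom_ident
        tunit_Ob onOb_tunit onOb_Ob\<close>)
qed

text \<open>Tensor product and unit are preserved on the nose, so identities serve as comparison
  maps and the coherence diagrams collapse to identity laws in \<open>D\<close>.\<close>

lemma strong_monoidal:
  "strong_monoidal_functor C D F (\<lambda>X Y. ident D (onOb F (X \<otimes>\<^bsub>C\<^esub> Y))) (ident D (tunit D))"
proof -
  interpret C': monoidal_category C by (rule monoidal_category_source)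
  have tensor_ident: "ident D (onOb F X) \<odot>\<^bsub>D\<^esub> ident D (onOb F Y) = ident D (onOb F X \<otimes>\<^bsub>D\<^esub> onOb F Y)"
    if "X \<in> Ob C" "Y \<in> Ob C" for X Y
    using that by (intro D.tensor_map_ident onOb_Ob)
  show ?thesis
  proof (unfold_locales, goal_cases)
    case (1 X Y)
    then show ?case using D.ident_iso[of "onOb F (X \<otimes>\<^bsub>C\<^esub> Y)"]
      by (simp add: onOb_tensor D.tensor_Ob onOb_Ob)
  next
    case (2 f X X' g Y Y')
    note t = onHom_Hom[OF tensor_map_Hom[OF 2]]
    show ?case using D.ident_left[OF t] D.ident_right[OF t] by (simp add: onHom_tensor[OF 2])
  next
    case 3
    then show ?case using D.ident_iso[OF D.tunit_Ob] by (simp add: onOb_tunit)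
  next
    case (4 X Y Z)
    note Fo = onOb_Ob[OF 4(1)] onOb_Ob[OF 4(2)] onOb_Ob[OF 4(3)]
    have a: "assoc D (onOb F X) (onOb F Y) (onOb F Z) \<in> Hom D
        ((onOb F X \<otimes>\<^bsub>D\<^esub> onOb F Y) \<otimes>\<^bsub>D\<^esub> onOb F Z) (onOb F X \<otimes>\<^bsub>D\<^esub> (onOb F Y \<otimes>\<^bsub>D\<^esub> onOb F Z))"
      using D.assoc_iso[OF Fo] unfolding isos_def by blast
    note i = D.ident_left[OF a] D.ident_right[OF a]
    have "cmp D (ident D V) (ident D V) = ident D V" if "V \<in> Ob D" for V
      using D.ident_left[OF D.ident_Hom[OF that]] .
    then show ?case using 4 i
      by (simp add: onOb_tensor tensor_Ob onHom_assoc D.tensor_map_ident D.tensor_Ob onOb_Ob)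
  next
    case (5 X)
    note Fo = onOb_Ob[OF 5]
    have a: "lunit D (onOb F X) \<in> Hom D (tunit D \<otimes>\<^bsub>D\<^esub> onOb F X) (onOb F X)"
      using D.lunit_iso[OF Fo] unfolding isos_def by blast
    have "cmp D (ident D V) (ident D V) = ident D V" if "V \<in> Ob D" for V
      using D.ident_left[OF D.ident_Hom[OF that]] .
    then show ?case using 5 D.ident_right[OF a]
      by (simp add: onOb_tensor onOb_tunit onHom_lunit D.tensor_map_ident D.tensor_Ob onOb_Ob
          tunit_Ob D.tunit_Ob)
  next
    case (6 X)
    note Fo = onOb_Ob[OF 6]
    have a: "runit D (onOb F X) \<in> Hom D (onOb F X \<otimes>\<^bsub>D\<^esub> tunit D) (onOb F X)"
      using D.runit_iso[OF Fo] unfolding isos_def by blast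
    have "cmp D (ident D V) (ident D V) = ident D V" if "V \<in> Ob D" for V
      using D.ident_left[OF D.ident_Hom[OF that]] .
    then show ?case using 6 D.ident_right[OF a]
      by (simp add: onOb_tensor onOb_tunit onHom_runit D.tensor_map_ident D.tensor_Ob onOb_Ob
          tunit_Ob D.tunit_Ob)
  qed
qed

end

section \<open>The combinatorial category\<close>

lemma delta_iff:
  "\<theta> \<in> delta m n \<longleftrightarrow> \<theta> \<in> extensional {..m} \<and> (\<forall>i\<le>m. \<theta> i \<le> n) \<and> (\<forall>i j. i \<le> j \<longrightarrow> j \<le> m \<longrightarrow> \<theta> i \<le> \<theta> j)"
  unfolding delta_def PiE_def mono_on_def by auto

lemma delta_ident: "(\<lambda>i\<in>{..n}. i) \<in> delta n n"
  by (auto simp: delta_iff)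

lemma delta_const: "v \<le> n \<Longrightarrow> (\<lambda>i\<in>{..m}. v) \<in> delta m n"
  by (auto simp: delta_iff)

lemma delta_compose: "\<theta> \<in> delta l m \<Longrightarrow> \<zeta> \<in> delta m n \<Longrightarrow> compose {..l} \<zeta> \<theta> \<in> delta l n"
  by (auto simp: delta_iff compose_def)

lemma Ob_JointOrd: "X \<in> Ob JointOrd \<longleftrightarrow> 0 \<in> fst X \<and> snd X \<in> fst X \<and> fst X \<subseteq> {..snd X}"
  by (cases X) (auto simp: JointOrd_def)

text \<open>A hom-set stripped of endpoints, so that vertex maps can be handled as plain functions.
  That \<open>X\<close> and \<open>Y\<close> are objects is supplied separately.\<close>

definition joint_maps :: "joint_object \<Rightarrow> joint_object \<Rightarrow> (nat \<Rightarrow> nat) set" where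
  "joint_maps X Y = {f \<in> delta_f (snd X) (snd Y). fst Y \<subseteq> f ` fst X}"

lemma Hom_JointOrd:
  "h \<in> Hom JointOrd X Y \<longleftrightarrow>
    X \<in> Ob JointOrd \<and> Y \<in> Ob JointOrd \<and> (\<exists>f \<in> joint_maps X Y. h = (X, f, Y))"
  by (cases X; cases Y) (auto simp: JointOrd_def joint_maps_def)

lemma joint_mapsD:
  assumes "f \<in> joint_maps X Y"
  shows "f \<in> delta (snd X) (snd Y)" "f 0 = 0" "f (snd X) = snd Y" "fst Y \<subseteq> f ` fst X"
  using assms by (auto simp: joint_maps_def delta_f_def)

lemma joint_mapsI:
  assumes "f \<in> delta (snd X) (snd Y)" "f 0 = 0" "f (snd X) = snd Y" "fst Y \<subseteq> f ` fst X"
  shows "f \<in> joint_maps X Y"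
  using assms by (auto simp: joint_maps_def delta_f_def)

lemma joint_maps_le: "f \<in> joint_maps X Y \<Longrightarrow> i \<le> snd X \<Longrightarrow> f i \<le> snd Y"
  by (auto dest!: joint_mapsD(1) simp: delta_iff)

lemma joint_maps_mono: "f \<in> joint_maps X Y \<Longrightarrow> i \<le> j \<Longrightarrow> j \<le> snd X \<Longrightarrow> f i \<le> f j"
  by (auto dest!: joint_mapsD(1) simp: delta_iff)

lemma joint_maps_ident: "X \<in> Ob JointOrd \<Longrightarrow> (\<lambda>i\<in>{..snd X}. i) \<in> joint_maps X X"
  by (rule joint_mapsI) (auto simp: Ob_JointOrd delta_ident image_iff)

lemma joint_maps_compose:
  assumes "X \<in> Ob JointOrd" "f \<in> joint_maps X Y" "g \<in> joint_maps Y Z"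
  shows "compose {..snd X} g f \<in> joint_maps X Z"
proof (rule joint_mapsI)
  note f = joint_mapsD[OF assms(2)] and g = joint_mapsD[OF assms(3)]
  show "compose {..snd X} g f \<in> delta (snd X) (snd Z)" by (rule delta_compose[OF f(1) g(1)])
  show "compose {..snd X} g f 0 = 0" "compose {..snd X} g f (snd X) = snd Z"
    using f g by (auto simp: compose_def)
  \<comment> \<open>Joints of \<open>Z\<close> come from joints of \<open>Y\<close>, and these from
    joints of \<open>X\<close>.\<close>
  have "compose {..snd X} g f ` fst X = g ` f ` fst X"
    using assms(1) unfolding image_image by (intro image_cong) (auto simp: compose_def Ob_JointOrd)
  then show "fst Z \<subseteq> compose {..snd X} g f ` fst X" using f(4) g(4) by (simp only:) (meson image_mono order_trans)
qed

lemma JointOrd_simps: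
  "ident JointOrd = joint_ident" "cmp JointOrd (Y', g, Z) (X, f, Y) = (X, compose {..snd X} g f, Z)"
  "tensor JointOrd = joint_wedge"
  "tensor_map JointOrd (X, f, X') (Y, g, Y') =
    (joint_wedge X Y, join_map (snd X) (snd X') f (snd Y) g, joint_wedge X' Y')"
  "tunit JointOrd = ({0}, 0)"
  "assoc JointOrd X Y Z = joint_ident (joint_wedge X (joint_wedge Y Z))"
  "lunit JointOrd = joint_ident" "runit JointOrd = joint_ident"
  by (simp_all add: JointOrd_def)

lemma category_JointOrd: "category JointOrd"
proof
  show "f \<in> Hom JointOrd X Y \<Longrightarrow> X \<in> Ob JointOrd \<and> Y \<in> Ob JointOrd" for f X Y
    by (simp add: Hom_JointOrd)
  show "f \<in> Hom JointOrd X Y \<Longrightarrow> f \<in> Hom JointOrd X' Y' \<Longrightarrow> X = X' \<and> Y = Y'" for f X Y X' Y'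
    by (auto simp: Hom_JointOrd)
  show "X \<in> Ob JointOrd \<Longrightarrow> ident JointOrd X \<in> Hom JointOrd X X" for X
    by (simp add: Hom_JointOrd JointOrd_simps joint_ident_def joint_maps_ident)
  show "f \<in> Hom JointOrd X Y \<Longrightarrow> g \<in> Hom JointOrd Y Z \<Longrightarrow> cmp JointOrd g f \<in> Hom JointOrd X Z"
    for f g X Y Z
    by (auto simp: Hom_JointOrd JointOrd_simps intro: joint_maps_compose)
  show "f \<in> Hom JointOrd X Y \<Longrightarrow> cmp JointOrd (ident JointOrd Y) f = f" for f X Y
    by (auto simp: Hom_JointOrd JointOrd_simps joint_ident_def compose_def joint_maps_le
        dest!: joint_mapsD(1) simp: delta_iff intro!: extensionalityI[of _ "{..snd X}"])
  show "f \<in> Hom JointOrd X Y \<Longrightarrow> cmp JointOrd f (ident JointOrd X) = f" for f X Y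
    by (auto simp: Hom_JointOrd JointOrd_simps joint_ident_def compose_def joint_maps_le
        dest!: joint_mapsD(1) simp: delta_iff intro!: extensionalityI[of _ "{..snd X}"])
  show "f \<in> Hom JointOrd W X \<Longrightarrow> g \<in> Hom JointOrd X Y \<Longrightarrow> h \<in> Hom JointOrd Y Z
    \<Longrightarrow> cmp JointOrd (cmp JointOrd h g) f = cmp JointOrd h (cmp JointOrd g f)" for f g h W X Y Z
    by (auto simp: Hom_JointOrd JointOrd_simps compose_def joint_maps_le intro!: restrict_ext)
qed

section \<open>Concatenation of joint objects and of their maps\<close>

lemma joint_wedge_eq: "joint_wedge X Y = (fst X \<union> (+) (snd X) ` fst Y, snd X + snd Y)"
  by (auto simp: joint_wedge_def split: prod.split)

lemma joint_wedge_simps [simp]: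
  "fst (joint_wedge X Y) = fst X \<union> (+) (snd X) ` fst Y" "snd (joint_wedge X Y) = snd X + snd Y"
  by (simp_all add: joint_wedge_eq)

lemma joint_wedge_Ob: "X \<in> Ob JointOrd \<Longrightarrow> Y \<in> Ob JointOrd \<Longrightarrow> joint_wedge X Y \<in> Ob JointOrd"
  by (force simp: Ob_JointOrd)

lemma joint_wedge_assoc: "joint_wedge (joint_wedge X Y) Z = joint_wedge X (joint_wedge Y Z)"
  by (simp add: joint_wedge_eq image_Un image_image add.assoc Un_assoc)

lemma joint_wedge_unit_left: "X \<in> Ob JointOrd \<Longrightarrow> joint_wedge ({0}, 0) X = X"
  by (auto simp: joint_wedge_eq Ob_JointOrd prod_eq_iff)

lemma joint_wedge_unit_right: "X \<in> Ob JointOrd \<Longrightarrow> joint_wedge X ({0}, 0) = X"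
  by (auto simp: joint_wedge_eq Ob_JointOrd prod_eq_iff)

lemma join_map_left: "i \<le> p \<Longrightarrow> join_map p p' f q g i = f i"
  by (simp add: join_map_def)

text \<open>The definition puts the seam \<open>snd X\<close> into the first branch. For
  \<open>j = 0\<close> the formula still holds, because \<open>f\<close> ends at
  \<open>snd X'\<close> and \<open>g\<close> starts at 0.\<close>

lemma join_map_right:
  assumes "f \<in> joint_maps X X'" "g \<in> joint_maps Y Y'" "j \<le> snd Y"
  shows "join_map (snd X) (snd X') f (snd Y) g (snd X + j) = snd X' + g j"
  using joint_mapsD[OF assms(1)] joint_mapsD[OF assms(2)] assms(3)
  by (cases "j = 0") (auto simp: join_map_def)

lemma le_add_cases:
  fixes i p q :: nat
  assumes "i \<le> p + q"
  obtains (left) "i \<le> p" | (right) j where "i = p + j" "j \<le> q"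
proof (cases "i \<le> p")
  case False
  then show ?thesis using right[of "i - p"] assms by simp
qed (rule left)

text \<open>Monotonicity across the seam holds because the left part stays at or below
  \<open>snd X'\<close> and the right part never goes below it. Joints are hit separately on the two
  sides.\<close>

lemma join_map_joint_maps:
  assumes f: "f \<in> joint_maps X X'" and g: "g \<in> joint_maps Y Y'"
    and X: "X \<in> Ob JointOrd" and Y: "Y \<in> Ob JointOrd"
  shows "join_map (snd X) (snd X') f (snd Y) g \<in> joint_maps (joint_wedge X Y) (joint_wedge X' Y')"
    (is "?h \<in> _")
proof (rule joint_mapsI)
  note fD = joint_mapsD[OF f] and gD = joint_mapsD[OF g]
  note left = join_map_left[of _ "snd X" "snd X'" f "snd Y" g]
  note right = join_map_right[OF f g]
  show "?h 0 = 0" using left[of 0] fD by simp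
  show "?h (snd (joint_wedge X Y)) = snd (joint_wedge X' Y')"
    using right[of "snd Y"] gD by simp
  have le: "?h i \<le> snd X' + snd Y'" if "i \<le> snd X + snd Y" for i
    using that
  proof (cases rule: le_add_cases)
    case left then show ?thesis using joint_maps_le[OF f left] by (simp add: join_map_left)
  next
    case (right j) then show ?thesis
      using joint_maps_le[OF g right(2)] by (simp add: join_map_right[OF f g])
  qed
  have mono: "?h i \<le> ?h k" if "i \<le> k" "k \<le> snd X + snd Y" for i k
    using that(2)
  proof (cases rule: le_add_cases)
    case left
    then show ?thesis using joint_maps_mono[OF f that(1) left] that by (simp add: join_map_left)
  next
    case k: (right j)
    have "i \<le> snd X + snd Y" using that by simp
    then show ?thesis
    proof (cases rule: le_add_cases)
      case left
      then show ?thesis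
        using joint_maps_le[OF f left] k by (simp add: join_map_left join_map_right[OF f g])
    next
      case (right j')
      then show ?thesis using joint_maps_mono[OF g, of j' j] k that
        by (simp add: join_map_right[OF f g])
    qed
  qed
  show "?h \<in> delta (snd (joint_wedge X Y)) (snd (joint_wedge X' Y'))"
    using le mono by (auto simp: delta_iff join_map_def)
  show "fst (joint_wedge X' Y') \<subseteq> ?h ` fst (joint_wedge X Y)"
  proof
    fix u assume "u \<in> fst (joint_wedge X' Y')"
    then consider "u \<in> fst X'" | v where "v \<in> fst Y'" "u = snd X' + v" by auto
    then show "u \<in> ?h ` fst (joint_wedge X Y)"
    proof cases
      case 1
      then obtain t where "t \<in> fst X" "u = f t" using fD(4) by auto
      then show ?thesis using X left[of t] by (auto simp: Ob_JointOrd intro!: rev_image_eqI[of t])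
    next
      case 2
      then obtain t where t: "t \<in> fst Y" "v = g t" using gD(4) by auto
      then have "u = ?h (snd X + t)" using Y right[of t] 2 by (auto simp: Ob_JointOrd)
      then show ?thesis using t(1) by auto
    qed
  qed
qed

text \<open>Reduces equality with a concatenation to a check on two blocks. The seam
  \<open>p\<close> lies in both; the condition on the left block settles the value there.\<close>

lemma join_map_ext:
  assumes "h \<in> extensional {..p + q}" "\<And>i. i \<le> p \<Longrightarrow> h i = f i" "\<And>j. j \<le> q \<Longrightarrow> h (p + j) = p' + g j"
  shows "join_map p p' f q g = h"
proof (rule extensionalityI[of _ "{..p + q}"])
  fix i assume "i \<in> {..p + q}"
  then have "i \<le> p + q" by simp
  then show "join_map p p' f q g i = h i"
  proof (cases rule: le_add_cases)
    case (right j)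
    then show ?thesis using assms(2)[of p] assms(3)[of j] by (cases "j = 0") (auto simp: join_map_def)
  qed (simp add: join_map_def assms)
qed (use assms(1) in \<open>auto simp: join_map_def\<close>)

lemma join_map_ident: "join_map p p (\<lambda>i\<in>{..p}. i) q (\<lambda>i\<in>{..q}. i) = (\<lambda>i\<in>{..p + q}. i)"
  by (rule join_map_ext) auto

lemma ident_JointOrd_iso: "X \<in> Ob JointOrd \<Longrightarrow> X = Y \<Longrightarrow> joint_ident X \<in> isos JointOrd Y Y"
  using category.ident_iso[OF category_JointOrd, of X] by (simp add: JointOrd_simps)

lemma joint_ident_tensor:
  "tensor_map JointOrd (joint_ident X) (joint_ident Y) = joint_ident (joint_wedge X Y)"
  by (simp add: joint_ident_def JointOrd_simps join_map_ident)

lemma joint_ident_cmp: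
  assumes "f \<in> Hom JointOrd X Y"
  shows "cmp JointOrd (joint_ident Y) f = f" "cmp JointOrd f (joint_ident X) = f"
  using category.ident_left[OF category_JointOrd assms]
    category.ident_right[OF category_JointOrd assms] by (simp_all add: JointOrd_simps)

lemma monoidal_JointOrd: "monoidal_category JointOrd"
proof -
  interpret category JointOrd by (rule category_JointOrd)
  have tensor_Hom: "tensor_map JointOrd f g \<in> Hom JointOrd (joint_wedge X Y) (joint_wedge X' Y')"
    if "f \<in> Hom JointOrd X X'" "g \<in> Hom JointOrd Y Y'" for f g X X' Y Y'
    using that join_map_joint_maps[of _ X X' _ Y Y']
    by (auto simp: Hom_JointOrd JointOrd_simps joint_wedge_Ob)
  have id2: "cmp JointOrd (joint_ident X) (joint_ident X) = joint_ident X" if "X \<in> Ob JointOrd" for X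
    using ident_left[OF ident_Hom[OF that]] by (simp add: JointOrd_simps)
  \<comment> \<open>With identities as associators, naturality amounts to strict associativity of
    concatenation.\<close>
  have tensor_assoc: "tensor_map JointOrd (tensor_map JointOrd f g) h
      = tensor_map JointOrd f (tensor_map JointOrd g h)"
    if fgh: "f \<in> Hom JointOrd X X'" "g \<in> Hom JointOrd Y Y'" "h \<in> Hom JointOrd Z Z'" for f g h X X' Y Y' Z Z'
  proof -
    obtain a b c where abc: "f = (X, a, X')" "g = (Y, b, Y')" "h = (Z, c, Z')"
      "a \<in> joint_maps X X'" "b \<in> joint_maps Y Y'" "c \<in> joint_maps Z Z'"
      using fgh unfolding Hom_JointOrd by blast
    let ?bc = "join_map (snd Y) (snd Y') b (snd Z) c"
    have bc: "?bc \<in> joint_maps (joint_wedge Y Z) (joint_wedge Y' Z')"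
      using fgh abc by (intro join_map_joint_maps) (auto simp: Hom_JointOrd)
    note right = join_map_right[OF abc(4) bc, simplified]
    have "join_map (snd X + snd Y) (snd X' + snd Y')
        (join_map (snd X) (snd X') a (snd Y) b) (snd Z) c
      = join_map (snd X) (snd X') a (snd Y + snd Z) ?bc"
    proof (rule join_map_ext)
      show "join_map (snd X) (snd X') a (snd Y + snd Z) ?bc \<in> extensional {..snd X + snd Y + snd Z}"
        by (simp add: join_map_def add.assoc)
      fix i
      show "join_map (snd X) (snd X') a (snd Y + snd Z) ?bc i
          = join_map (snd X) (snd X') a (snd Y) b i" if "i \<le> snd X + snd Y"
        using that
        by (cases rule: le_add_cases)
          (auto simp: join_map_left join_map_right[OF abc(4,5)] right)
      show "join_map (snd X) (snd X') a (snd Y + snd Z) ?bc (snd X + snd Y + i)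
          = snd X' + snd Y' + c i" if "i \<le> snd Z"
        using that right[of "snd Y + i"] by (simp add: join_map_right[OF abc(5,6)] add.assoc)
    qed
    then show ?thesis by (simp add: abc JointOrd_simps joint_wedge_assoc)
  qed
  \<comment> \<open>Concatenation with the one-point chain changes nothing, which gives naturality
    of both unitors.\<close>
  have tensor_unit: "tensor_map JointOrd (joint_ident ({0}, 0)) f = f"
    "tensor_map JointOrd f (joint_ident ({0}, 0)) = f" if f: "f \<in> Hom JointOrd X Y" for f X Y
  proof -
    obtain a where a: "f = (X, a, Y)" "a \<in> joint_maps X Y" and ob: "X \<in> Ob JointOrd" "Y \<in> Ob JointOrd"
      using f by (auto simp: Hom_JointOrd)
    note a' = joint_mapsD[OF a(2)]
    have "join_map 0 0 (\<lambda>i\<in>{..0}. i) (snd X) a = a"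
      by (rule join_map_ext) (use a' in \<open>auto simp: delta_iff\<close>)
    moreover have "join_map (snd X) (snd Y) a 0 (\<lambda>i\<in>{..0}. i) = a"
      by (rule join_map_ext) (use a' in \<open>auto simp: delta_iff\<close>)
    ultimately show "tensor_map JointOrd (joint_ident ({0}, 0)) f = f"
      "tensor_map JointOrd f (joint_ident ({0}, 0)) = f"
      using a ob by (auto simp: joint_ident_def JointOrd_simps joint_wedge_unit_left joint_wedge_unit_right)
  qed
  have unit_Ob: "({0}, 0) \<in> Ob JointOrd" by (simp add: Ob_JointOrd)
  note ident_simps = joint_ident_tensor id2 joint_wedge_Ob
  show ?thesis
  proof (unfold_locales, goal_cases)
    case (3 f X X' g Y Y')
    then show ?case using tensor_Hom by (simp add: JointOrd_simps)
  next
    case (5 f X X' f' X'' g Y Y' g' Y'')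
    obtain a a' b b' where abc: "f = (X, a, X')" "f' = (X', a', X'')" "g = (Y, b, Y')" "g' = (Y', b', Y'')"
      "a \<in> joint_maps X X'" "a' \<in> joint_maps X' X''" "b \<in> joint_maps Y Y'" "b' \<in> joint_maps Y' Y''"
      using 5 unfolding Hom_JointOrd by blast
    let ?h = "compose {..snd X + snd Y} (join_map (snd X') (snd X'') a' (snd Y') b')
        (join_map (snd X) (snd X') a (snd Y) b)"
    have "join_map (snd X) (snd X'') (compose {..snd X} a' a) (snd Y) (compose {..snd Y} b' b) = ?h"
    proof (rule join_map_ext)
      show "?h i = compose {..snd X} a' a i" if "i \<le> snd X" for i
        using that joint_maps_le[OF abc(5) that] by (simp add: compose_def join_map_left)
      show "?h (snd X + j) = snd X'' + compose {..snd Y} b' b j" if "j \<le> snd Y" for j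
        using that joint_maps_le[OF abc(7) that]
        by (simp add: compose_def join_map_right[OF abc(5,7)] join_map_right[OF abc(6,8)])
    qed simp
    then show ?case by (simp add: abc JointOrd_simps)
  next
    case (6 X Y Z)
    then show ?case
      by (simp add: JointOrd_simps joint_wedge_assoc ident_JointOrd_iso joint_wedge_Ob)
  next
    case (7 f X X' g Y Y' h Z Z')
    note t = tensor_Hom[OF 7(1) tensor_Hom[OF 7(2,3)]]
    show ?case
      using joint_ident_cmp[OF t] tensor_assoc[OF 7] by (simp add: JointOrd_simps)
  next
    case (8 X)
    then show ?case by (simp add: JointOrd_simps ident_JointOrd_iso joint_wedge_unit_left)
  next
    case (9 f X Y)
    then show ?case using joint_ident_cmp[OF 9] tensor_unit[OF 9] by (simp add: JointOrd_simps)
  next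
    case (10 X)
    then show ?case by (simp add: JointOrd_simps ident_JointOrd_iso joint_wedge_unit_right)
  next
    case (11 f X Y)
    then show ?case using joint_ident_cmp[OF 11] tensor_unit[OF 11] by (simp add: JointOrd_simps)
  next
    case (13 X Y)
    then show ?case
      using joint_wedge_assoc[of X "({0}, 0)" Y]
      by (simp add: JointOrd_simps ident_simps joint_wedge_unit_left joint_wedge_unit_right)
  qed (simp_all add: JointOrd_simps ident_simps joint_wedge_assoc unit_Ob)
qed

section \<open>Wedges and vertex labels\<close>

text \<open>\<open>{..0}\<close> is the poset \<open>[0]\<close> and has to be matched by the lemmas about \<open>delta\<close>.\<close>

declare atMost_0 [simp del]

lemma (in bipointed_simplicial_set) degen_simp: "v \<in> simp K 0 \<Longrightarrow> degen K n v \<in> simp K n"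
  unfolding degen_def by (rule act_simp[OF delta_const]) auto

text \<open>There is just one map to \<open>[0]\<close>, so a simplex degenerate on a vertex remains
  so under every operator.\<close>

lemma (in bipointed_simplicial_set) act_degen:
  assumes "\<theta> \<in> delta m n" "v \<in> simp K 0"
  shows "act K m n \<theta> (degen K n v) = degen K m v"
proof -
  have "compose {..m} (\<lambda>i\<in>{..n}. 0) \<theta> = (\<lambda>i\<in>{..m}. 0 :: nat)"
    using assms(1) by (auto simp: compose_def delta_iff)
  then show ?thesis
    unfolding degen_def using act_compose[OF assms(1) delta_const[of 0 0 n] assms(2)] by simp
qed

lemma (in bipointed_simplicial_set) degen_0: "v \<in> simp K 0 \<Longrightarrow> degen K 0 v = v"
  using act_ident[of v 0] unfolding degen_def
  by (simp add: restrict_def cong: if_cong)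

text \<open>In each degree the gluing merges one simplex of \<open>K\<close> with one of
  \<open>L\<close>, never two of the same summand.\<close>

lemma left_in_eq_iff [simp]: "left_in K L n x = left_in K L n x' \<longleftrightarrow> x = x'"
  by (auto simp: left_in_def glue_def Let_def split: if_splits)

lemma right_in_eq_iff [simp]: "right_in K L n y = right_in K L n y' \<longleftrightarrow> y = y'"
  by (auto simp: right_in_def glue_def Let_def split: if_splits)

lemma left_in_eq_right_in_iff:
  "left_in K L n x = right_in K L n y \<longleftrightarrow> x = degen K n (tgt K) \<and> y = degen L n (src L)"
  by (auto simp: left_in_def right_in_def glue_def Let_def split: if_splits)

text \<open>\<open>wedge_case\<close> evaluates an arbitrary representative. Only the glued class
  has representatives in both summands, and there the assumption makes the two branches
  agree.\<close>

lemma wedge_case_left_in: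
  assumes "f (degen K n (tgt K)) = g (degen L n (src L))"
  shows "wedge_case f g (left_in K L n x) = f x"
proof (cases "x = degen K n (tgt K)")
  case True
  let ?z = "SOME z. z |\<in>| un_Cls (left_in K L n x)"
  have "InL x |\<in>| un_Cls (left_in K L n x)" using True by (simp add: left_in_def glue_def)
  then have "?z |\<in>| un_Cls (left_in K L n x)" by (rule someI)
  then have "?z = InL x \<or> ?z = InR (degen L n (src L))"
    using True by (simp add: left_in_def glue_def)
  then show ?thesis using assms True by (auto simp: wedge_case_def)
next
  case False
  then show ?thesis by (simp add: wedge_case_def left_in_def glue_def Let_def)
qed

lemma wedge_case_right_in:
  assumes "f (degen K n (tgt K)) = g (degen L n (src L))"
  shows "wedge_case f g (right_in K L n y) = g y"
proof (cases "y = degen L n (src L)")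
  case True
  then have "right_in K L n y = left_in K L n (degen K n (tgt K))"
    by (metis left_in_eq_right_in_iff)
  then show ?thesis using wedge_case_left_in[of f K n g L, OF assms] assms True by simp
next
  case False
  then show ?thesis by (simp add: wedge_case_def right_in_def glue_def Let_def)
qed

lemma simp_wedge: "simp (K \<or>\<^sub>w L) n = left_in K L n ` simp K n \<union> right_in K L n ` simp L n"
  by (auto simp: wedge_def left_in_def right_in_def)

lemma wedge_simplexE:
  assumes "w \<in> simp (K \<or>\<^sub>w L) n"
  obtains (left) x where "x \<in> simp K n" "w = left_in K L n x"
  | (right) y where "y \<in> simp L n" "w = right_in K L n y"
  using assms by (auto simp: simp_wedge)

lemma left_in_simp [simp]: "x \<in> simp K n \<Longrightarrow> left_in K L n x \<in> simp (K \<or>\<^sub>w L) n"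
  and right_in_simp [simp]: "y \<in> simp L n \<Longrightarrow> right_in K L n y \<in> simp (K \<or>\<^sub>w L) n"
  by (simp_all add: simp_wedge)

lemma src_wedge: "src (K \<or>\<^sub>w L) = left_in K L 0 (src K)"
  and tgt_wedge: "tgt (K \<or>\<^sub>w L) = right_in K L 0 (tgt L)"
  by (simp_all add: wedge_def)

locale bipointed_pair = K: bipointed_simplicial_set K + L: bipointed_simplicial_set L
  for K L :: "'a cell bisset"
begin

lemma glued: "left_in K L n (degen K n (tgt K)) = right_in K L n (degen L n (src L))"
  by (simp add: left_in_eq_right_in_iff)

text \<open>Operators send the glued degenerate simplices of both summands to the glued ones of the
  new degree, so the case distinction is well defined.\<close>

lemma act_wedge:
  assumes "\<theta> \<in> delta m n"
  shows "act (K \<or>\<^sub>w L) m n \<theta> (left_in K L n x) = left_in K L m (act K m n \<theta> x)"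
    and "act (K \<or>\<^sub>w L) m n \<theta> (right_in K L n y) = right_in K L m (act L m n \<theta> y)"
  using wedge_case_left_in[of "\<lambda>x. left_in K L m (act K m n \<theta> x)" K n "\<lambda>y. right_in K L m (act L m n \<theta> y)" L]
    wedge_case_right_in[of "\<lambda>x. left_in K L m (act K m n \<theta> x)" K n "\<lambda>y. right_in K L m (act L m n \<theta> y)" L]
  by (simp_all add: wedge_def K.act_degen L.act_degen assms K.tgt_simp L.src_simp glued)

lemma bipointed_wedge: "bipointed_simplicial_set (K \<or>\<^sub>w L)"
proof
  show "act (K \<or>\<^sub>w L) m n \<theta> w \<in> simp (K \<or>\<^sub>w L) m"
    if "\<theta> \<in> delta m n" "w \<in> simp (K \<or>\<^sub>w L) n" for \<theta> m n w
    using that(2) by (cases rule: wedge_simplexE) (simp_all add: act_wedge that(1) K.act_simp L.act_simp)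
  show "act (K \<or>\<^sub>w L) n n (\<lambda>i\<in>{..n}. i) w = w" if "w \<in> simp (K \<or>\<^sub>w L) n" for n w
    using that by (cases rule: wedge_simplexE) (simp_all add: act_wedge delta_ident K.act_ident L.act_ident)
  show "act (K \<or>\<^sub>w L) l m \<theta> (act (K \<or>\<^sub>w L) m n \<zeta> w) = act (K \<or>\<^sub>w L) l n (compose {..l} \<zeta> \<theta>) w"
    if "\<theta> \<in> delta l m" "\<zeta> \<in> delta m n" "w \<in> simp (K \<or>\<^sub>w L) n" for \<theta> \<zeta> l m n w
    using that(3) delta_compose[OF that(1,2)]
    by (cases rule: wedge_simplexE)
      (simp_all add: act_wedge that(1,2) K.act_compose[OF that(1,2)] L.act_compose[OF that(1,2)])
  show "src (K \<or>\<^sub>w L) \<in> simp (K \<or>\<^sub>w L) 0" "tgt (K \<or>\<^sub>w L) \<in> simp (K \<or>\<^sub>w L) 0"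
    by (simp_all add: src_wedge tgt_wedge K.src_simp L.tgt_simp)
qed

end

lemma bipointed_std_simplex: "bipointed_simplicial_set (std_simplex n)"
proof
  show "act (std_simplex n) l m \<theta> (act (std_simplex n) m k \<zeta> x)
      = act (std_simplex n) l k (compose {..l} \<zeta> \<theta>) x"
    if "\<theta> \<in> delta l m" for l m k \<theta> \<zeta> and x :: "'a cell"
    using that by (auto simp: std_simplex_def compose_def delta_iff)
  show "act (std_simplex n) m m (\<lambda>i\<in>{..m}. i) x = x" if "x \<in> simp (std_simplex n) m"
    for m and x :: "'a cell"
    using that by (auto simp: std_simplex_def compose_def delta_iff intro!: extensionalityI[of _ "{..m}"])
qed (auto simp: std_simplex_def delta_const delta_compose)

section \<open>Bipointed maps, vertices and vertex labels\<close>

lemma bipointed_mapsD: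
  assumes "f \<in> bipointed_maps K L"
  shows "x \<in> simp K n \<Longrightarrow> f n x \<in> simp L n" "f n \<in> extensional (simp K n)"
    "\<theta> \<in> delta m n \<Longrightarrow> x \<in> simp K n \<Longrightarrow> f m (act K m n \<theta> x) = act L m n \<theta> (f n x)"
    "f 0 (src K) = src L" "f 0 (tgt K) = tgt L"
  using assms by (auto simp: bipointed_maps_def PiE_def)

lemma bipointed_mapsI:
  assumes "\<And>n x. x \<in> simp K n \<Longrightarrow> f n x \<in> simp L n" "\<And>n. f n \<in> extensional (simp K n)"
    "\<And>m n \<theta> x. \<theta> \<in> delta m n \<Longrightarrow> x \<in> simp K n \<Longrightarrow> f m (act K m n \<theta> x) = act L m n \<theta> (f n x)"
    "f 0 (src K) = src L" "f 0 (tgt K) = tgt L"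
  shows "f \<in> bipointed_maps K L"
  using assms by (auto simp: bipointed_maps_def PiE_def)

definition vertex :: "'a bisset \<Rightarrow> nat \<Rightarrow> nat \<Rightarrow> 'a \<Rightarrow> 'a" where
  "vertex K n i x = act K 0 n (\<lambda>j\<in>{..0}. i) x"

lemma (in bipointed_simplicial_set) vertex_simp: "i \<le> n \<Longrightarrow> x \<in> simp K n \<Longrightarrow> vertex K n i x \<in> simp K 0"
  unfolding vertex_def by (rule act_simp[OF delta_const])

lemma (in bipointed_simplicial_set) vertex_0: "x \<in> simp K 0 \<Longrightarrow> vertex K 0 0 x = x"
  using degen_0 by (simp add: vertex_def degen_def)

lemma (in bipointed_simplicial_set) vertex_degen:
  "i \<le> n \<Longrightarrow> v \<in> simp K 0 \<Longrightarrow> vertex K n i (degen K n v) = v"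
  unfolding vertex_def by (simp add: act_degen delta_const degen_0)

lemma (in bipointed_simplicial_set) vertex_act:
  assumes "\<theta> \<in> delta m n" "i \<le> m" "x \<in> simp K n"
  shows "vertex K m i (act K m n \<theta> x) = vertex K n (\<theta> i) x"
proof -
  have "compose {..0::nat} \<theta> (\<lambda>j\<in>{..0}. i) = (\<lambda>j\<in>{..0}. \<theta> i)" by (auto simp: compose_def)
  then show ?thesis
    unfolding vertex_def using act_compose[OF delta_const[OF assms(2)] assms(1,3)] by simp
qed

lemma vertex_bipointed_map:
  "f \<in> bipointed_maps K L \<Longrightarrow> i \<le> n \<Longrightarrow> x \<in> simp K n \<Longrightarrow> vertex L n i (f n x) = f 0 (vertex K n i x)"
  unfolding vertex_def by (rule bipointed_mapsD(3)[OF _ delta_const, symmetric])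

definition vertex_labels :: "'a bisset \<Rightarrow> ('a \<Rightarrow> nat) \<Rightarrow> nat \<Rightarrow> 'a \<Rightarrow> nat \<Rightarrow> nat" where
  "vertex_labels K e n x = (\<lambda>i\<in>{..n}. e (vertex K n i x))"

lemma vertex_labels_bipointed_map:
  assumes "f \<in> bipointed_maps K L" "x \<in> simp K n"
  shows "vertex_labels L e n (f n x) = vertex_labels K (\<lambda>v. e (f 0 v)) n x"
  unfolding vertex_labels_def by (rule restrict_ext) (simp add: vertex_bipointed_map[OF assms(1) _ assms(2)])

lemma (in bipointed_simplicial_set) vertex_labels_act:
  assumes "\<theta> \<in> delta m n" "x \<in> simp K n"
  shows "vertex_labels K e m (act K m n \<theta> x) = compose {..m} (vertex_labels K e n x) \<theta>"
  using assms unfolding vertex_labels_def compose_def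
  by (intro restrict_ext) (auto simp: vertex_act delta_iff)

lemma (in bipointed_simplicial_set) vertex_labels_cong:
  assumes "\<And>v. v \<in> simp K 0 \<Longrightarrow> e v = e' v" "x \<in> simp K n"
  shows "vertex_labels K e n x = vertex_labels K e' n x"
  unfolding vertex_labels_def using assms by (intro restrict_ext) (simp add: vertex_simp)

text \<open>The simplices of the necklace with vertices \<open>{..p}\<close> and joints \<open>T\<close>: an \<open>n\<close>-simplex of \<open>\<Delta>\<^sup>p\<close>
  lies in one bead unless a joint separates its first vertex from its last.\<close>

definition bead_simplices :: "joint_object \<Rightarrow> nat \<Rightarrow> (nat \<Rightarrow> nat) set" where
  "bead_simplices X n = {\<theta> \<in> delta n (snd X). \<forall>t \<in> fst X. t \<le> \<theta> 0 \<or> \<theta> n \<le> t}"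

lemma bead_simplicesD:
  assumes "\<theta> \<in> bead_simplices X n"
  shows "i \<le> j \<Longrightarrow> j \<le> n \<Longrightarrow> \<theta> i \<le> \<theta> j" "t \<in> fst X \<Longrightarrow> t \<le> \<theta> 0 \<or> \<theta> n \<le> t"
  using assms by (auto simp: bead_simplices_def delta_iff)

text \<open>A joint of \<open>Y\<close> has the form \<open>g t\<close> with \<open>t\<close> a
  joint of \<open>X\<close>. As \<open>t\<close> does not separate the ends of the sequence,
  monotonicity keeps \<open>g t\<close> from separating the ends of its image.\<close>

lemma bead_simplices_compose:
  assumes g: "g \<in> joint_maps X Y" and X: "X \<in> Ob JointOrd" and \<theta>: "\<theta> \<in> bead_simplices X n"
  shows "compose {..n} g \<theta> \<in> bead_simplices Y n"
proof -
  have \<theta>': "\<theta> \<in> delta n (snd X)" "\<And>t. t \<in> fst X \<Longrightarrow> t \<le> \<theta> 0 \<or> \<theta> n \<le> t"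
    using \<theta> by (auto simp: bead_simplices_def)
  have le: "\<theta> 0 \<le> snd X" "\<theta> n \<le> snd X" using \<theta>'(1) by (auto simp: delta_iff)
  have "u \<le> g (\<theta> 0) \<or> g (\<theta> n) \<le> u" if u: "u \<in> fst Y" for u
  proof -
    obtain t where t: "t \<in> fst X" "u = g t" using u joint_mapsD(4)[OF g] by auto
    then have "t \<le> snd X" using X by (auto simp: Ob_JointOrd)
    then show ?thesis using \<theta>'(2)[OF t(1)] le t(2) joint_maps_mono[OF g] by blast
  qed
  then show ?thesis
    using delta_compose[OF \<theta>'(1) joint_mapsD(1)[OF g]] by (auto simp: bead_simplices_def compose_def)
qed

text \<open>Says that \<open>K\<close> is the union of the beads inside the simplex on
  \<open>{..snd X}\<close>: by \<open>vertex_labels_act\<close> the bijections commute with the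
  operators. This is independent of bracketings and of the encoding of wedges.\<close>

locale labelling = bipointed_simplicial_set K for K :: "'a bisset" +
  fixes X :: joint_object and e :: "'a \<Rightarrow> nat"
  assumes X_Ob: "X \<in> Ob JointOrd"
    and labels_bij: "bij_betw (vertex_labels K e n) (simp K n) (bead_simplices X n)"
    and label_src: "e (src K) = 0"
    and label_tgt: "e (tgt K) = snd X"
begin

lemma labels_in: "x \<in> simp K n \<Longrightarrow> vertex_labels K e n x \<in> bead_simplices X n"
  using labels_bij by (rule bij_betwE[rule_format])

lemma simplex_eqI:
  "x \<in> simp K n \<Longrightarrow> y \<in> simp K n \<Longrightarrow> vertex_labels K e n x = vertex_labels K e n y \<Longrightarrow> x = y"
  using labels_bij[of n] by (auto simp: bij_betw_def dest: inj_onD)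

lemma simplex_exists:
  assumes "\<theta> \<in> bead_simplices X n"
  obtains x where "x \<in> simp K n" "vertex_labels K e n x = \<theta>"
  using assms labels_bij[of n] that by (metis bij_betw_imp_surj_on imageE)

lemma label_le: assumes "v \<in> simp K 0" shows "e v \<le> snd X"
  using labels_in[OF assms] vertex_0[OF assms] by (auto simp: vertex_labels_def bead_simplices_def delta_iff)

lemma vertex_eqI: "v \<in> simp K 0 \<Longrightarrow> w \<in> simp K 0 \<Longrightarrow> e v = e w \<Longrightarrow> v = w"
  by (rule simplex_eqI) (auto simp: vertex_labels_def vertex_0 intro!: restrict_ext)

lemma vertex_exists:
  assumes "i \<le> snd X"
  obtains v where "v \<in> simp K 0" "e v = i"
proof -
  \<comment> \<open>No joint separates a constant sequence, so every number up to
    \<open>snd X\<close> labels a vertex.\<close>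
  have "(\<lambda>j\<in>{..0}. i) \<in> bead_simplices X 0" using assms by (auto simp: bead_simplices_def delta_const)
  then obtain v where v: "v \<in> simp K 0" "vertex_labels K e 0 v = (\<lambda>j\<in>{..0}. i)" by (rule simplex_exists)
  have "e v = i" using fun_cong[OF v(2), of 0] v(1) by (simp add: vertex_labels_def vertex_0)
  with v(1) show ?thesis by (rule that)
qed

lemma label_inv: "i \<le> snd X \<Longrightarrow> inv_into (simp K 0) e i \<in> simp K 0 \<and> e (inv_into (simp K 0) e i) = i"
  by (metis vertex_exists f_inv_into_f image_eqI inv_into_into)

lemma inv_label: "v \<in> simp K 0 \<Longrightarrow> inv_into (simp K 0) e (e v) = v"
  using vertex_eqI by (intro inv_into_f_f) (auto simp: inj_on_def)

end

text \<open>Take \<open>t\<close> least among the joints sent above \<open>u\<close>, and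
  \<open>s\<close> the joint before it. Minimality gives \<open>f s \<le> u\<close>, and equality is
  excluded because \<open>u\<close> is the image of no joint.\<close>

lemma next_joint:
  fixes f :: "nat \<Rightarrow> nat"
  assumes T: "T \<subseteq> {..p}" "0 \<in> T" "p \<in> T" and u: "f 0 \<le> u" "u \<le> f p" "u \<notin> f ` T"
  obtains s t where "s \<in> T" "t \<in> T" "s < t" "f s < u" "u < f t" "\<And>r. r \<in> T \<Longrightarrow> r \<le> s \<or> t \<le> r"
proof -
  have fin: "finite T" using T(1) finite_subset by blast
  define t where "t = (LEAST t. t \<in> T \<and> u < f t)"
  have "p \<in> T \<and> u < f p" using T u by (metis image_eqI le_neq_implies_less)
  then have t: "t \<in> T" "u < f t" and t_least: "\<And>r. r \<in> T \<Longrightarrow> u < f r \<Longrightarrow> t \<le> r"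
    unfolding t_def using LeastI[of "\<lambda>t. t \<in> T \<and> u < f t" p] Least_le[of "\<lambda>t. t \<in> T \<and> u < f t"] by auto
  have "t \<noteq> 0" using t u by (metis leD)
  define s where "s = Max {s \<in> T. s < t}"
  have ne: "finite {s \<in> T. s < t}" "{s \<in> T. s < t} \<noteq> {}" using fin T(2) \<open>t \<noteq> 0\<close> by auto
  have s: "s \<in> T" "s < t" using Max_in[OF ne] unfolding s_def by auto
  have "r \<le> s \<or> t \<le> r" if "r \<in> T" for r
    using that Max_ge[OF ne(1), of r] unfolding s_def by force
  moreover have "f s < u"
    using t_least[OF s(1)] s u(3) by (metis image_eqI leD linorder_neqE_nat)
  ultimately show ?thesis using that s t by blast
qed

section \<open>Bipointed maps between labelled objects\<close>

locale labelled_pair = K: labelling K X e + L: labelling L Y d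
  for K :: "'a bisset" and X e and L :: "'b bisset" and Y d
begin

lemma labels_map:
  assumes f: "f \<in> bipointed_maps K L" and g: "\<And>v. v \<in> simp K 0 \<Longrightarrow> d (f 0 v) = g (e v)"
    and x: "x \<in> simp K n"
  shows "vertex_labels L d n (f n x) = compose {..n} g (vertex_labels K e n x)"
  unfolding vertex_labels_def compose_def
  by (rule restrict_ext) (simp add: vertex_bipointed_map[OF f _ x] K.vertex_simp[OF _ x] g)

text \<open>The labels of an image depend only on the images of the vertices, and labels separate
  the simplices of \<open>L\<close>.\<close>

lemma bipointed_map_eqI:
  assumes f: "f \<in> bipointed_maps K L" and f': "f' \<in> bipointed_maps K L"
    and eq: "\<And>v. v \<in> simp K 0 \<Longrightarrow> d (f 0 v) = d (f' 0 v)"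
  shows "f = f'"
proof
  fix n
  show "f n = f' n"
  proof (rule extensionalityI[OF bipointed_mapsD(2)[OF f] bipointed_mapsD(2)[OF f']])
    fix x assume x: "x \<in> simp K n"
    have eq: "vertex_labels L d n (f n x) = vertex_labels L d n (f' n x)"
      unfolding vertex_labels_bipointed_map[OF f x] vertex_labels_bipointed_map[OF f' x]
      by (rule K.vertex_labels_cong[OF eq x])
    show "f n x = f' n x"
      by (rule L.simplex_eqI[OF bipointed_mapsD(1)[OF f x] bipointed_mapsD(1)[OF f' x] eq])
  qed
qed

text \<open>Compatibility with the operators comes for free: both sides have the same labels, and
  labels separate the simplices of \<open>L\<close>.\<close>

lemma bipointed_mapI:
  assumes g: "g \<in> joint_maps X Y"
    and simp: "\<And>n x. x \<in> simp K n \<Longrightarrow> f n x \<in> simp L n" and ext: "\<And>n. f n \<in> extensional (simp K n)"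
    and labels: "\<And>n x. x \<in> simp K n \<Longrightarrow>
      vertex_labels L d n (f n x) = compose {..n} g (vertex_labels K e n x)"
  shows "f \<in> bipointed_maps K L" "\<And>v. v \<in> simp K 0 \<Longrightarrow> d (f 0 v) = g (e v)"
proof -
  show f0: "d (f 0 v) = g (e v)" if "v \<in> simp K 0" for v
    using fun_cong[OF labels[OF that], of 0] that simp[OF that]
    by (simp add: vertex_labels_def compose_def K.vertex_0 L.vertex_0)
  show "f \<in> bipointed_maps K L"
  proof (rule bipointed_mapsI)
    fix m n \<theta> x assume \<theta>: "\<theta> \<in> delta m n" and x: "x \<in> simp K n"
    have eq: "vertex_labels L d m (f m (act K m n \<theta> x)) = vertex_labels L d m (act L m n \<theta> (f n x))"
      using \<theta> unfolding labels[OF K.act_simp[OF \<theta> x]] L.vertex_labels_act[OF \<theta> simp[OF x]] labels[OF x]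
        K.vertex_labels_act[OF \<theta> x] by (auto simp: compose_def delta_iff)
    show "f m (act K m n \<theta> x) = act L m n \<theta> (f n x)"
      by (rule L.simplex_eqI[OF simp[OF K.act_simp[OF \<theta> x]] L.act_simp[OF \<theta> simp[OF x]] eq])
  next
    show "f 0 (src K) = src L"
      by (rule L.vertex_eqI) (simp_all add: simp f0 K.src_simp L.src_simp K.label_src L.label_src
          joint_mapsD[OF g])
    show "f 0 (tgt K) = tgt L"
      by (rule L.vertex_eqI) (simp_all add: simp f0 K.tgt_simp L.tgt_simp K.label_tgt L.label_tgt
          joint_mapsD[OF g])
  qed (use simp ext in auto)
qed

text \<open>By \<open>bead_simplices_compose\<close> the composed label sequence is again one of a
  simplex of \<open>L\<close>, which is taken as the image.\<close>

lemma bipointed_map_exists: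
  assumes g: "g \<in> joint_maps X Y"
  obtains f where "f \<in> bipointed_maps K L" "\<And>v. v \<in> simp K 0 \<Longrightarrow> d (f 0 v) = g (e v)"
proof -
  have "\<exists>y. y \<in> simp L n \<and> vertex_labels L d n y = compose {..n} g (vertex_labels K e n x)"
    if "x \<in> simp K n" for n x
    using L.simplex_exists[OF bead_simplices_compose[OF g K.X_Ob K.labels_in[OF that]]] by metis
  then have "\<forall>n x. \<exists>y. x \<in> simp K n \<longrightarrow>
      y \<in> simp L n \<and> vertex_labels L d n y = compose {..n} g (vertex_labels K e n x)"
    by blast
  then obtain f where f: "\<And>n x. x \<in> simp K n \<Longrightarrow>
      f n x \<in> simp L n \<and> vertex_labels L d n (f n x) = compose {..n} g (vertex_labels K e n x)"
    unfolding choice_iff by blast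
  show ?thesis
    using bipointed_mapI[OF g, of "\<lambda>n. restrict (f n) (simp K n)"] f
    by (intro that[of "\<lambda>n. restrict (f n) (simp K n)"]) auto
qed

lemma joint_map_of_bipointed_map:
  assumes f: "f \<in> bipointed_maps K L" and ext: "g \<in> extensional {..snd X}"
    and g: "\<And>v. v \<in> simp K 0 \<Longrightarrow> d (f 0 v) = g (e v)"
  shows "g \<in> joint_maps X Y"
proof -
  \<comment> \<open>When no joint lies strictly between \<open>i\<close> and \<open>j\<close>, some
    edge of \<open>K\<close> has these labels. Its image is an edge of \<open>L\<close>, hence
    ascending and not crossing any joint of \<open>Y\<close>.\<close>
  have edge: "g i \<le> g j \<and> (\<forall>u \<in> fst Y. u \<le> g i \<or> g j \<le> u)"
    if "i \<le> j" "j \<le> snd X" "\<forall>t \<in> fst X. t \<le> i \<or> j \<le> t" for i j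
  proof -
    have "(\<lambda>k\<in>{..1}. if k = 0 then i else j) \<in> bead_simplices X 1"
      using that by (auto simp: bead_simplices_def delta_iff)
    then obtain x where x: "x \<in> simp K 1" "vertex_labels K e 1 x = (\<lambda>k\<in>{..1}. if k = 0 then i else j)"
      by (rule K.simplex_exists)
    have *: "compose {..1} g (\<lambda>k\<in>{..1}. if k = 0 then i else j) \<in> bead_simplices Y 1"
      using L.labels_in[OF bipointed_mapsD(1)[OF f x(1)]] labels_map[OF f g x(1)] x(2) by simp
    show ?thesis using bead_simplicesD(1)[OF *, of 0 1] bead_simplicesD(2)[OF *] by (auto simp: compose_def)
  qed
  \<comment> \<open>Nothing lies strictly between consecutive numbers, so this edge always exists.
    Longer steps are chained, since an edge from \<open>i\<close> to \<open>j\<close> may be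
    missing.\<close>
  have step: "g i \<le> g (Suc i)" if "Suc i \<le> snd X" for i
    using edge[of i "Suc i"] that by (auto simp: not_less_eq_eq dest: not_less_eq_eq[THEN iffD1])
  have mono: "g i \<le> g j" if "i \<le> j" "j \<le> snd X" for i j
    using that by (induction rule: dec_induct) (auto intro: order_trans step)
  have le: "g i \<le> snd Y" if "i \<le> snd X" for i
    using K.vertex_exists[OF that] g L.label_le bipointed_mapsD(1)[OF f] by metis
  have ends: "g 0 = 0" "g (snd X) = snd Y"
    using g[OF K.src_simp] g[OF K.tgt_simp]
    by (simp_all add: bipointed_mapsD[OF f] K.label_src L.label_src K.label_tgt L.label_tgt)
  show ?thesis
  proof (rule joint_mapsI[OF _ ends])
    show "g \<in> delta (snd X) (snd Y)" using ext mono le by (auto simp: delta_iff)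
    show "fst Y \<subseteq> g ` fst X"
    proof (rule ccontr)
      assume "\<not> fst Y \<subseteq> g ` fst X"
      then obtain u where u: "u \<in> fst Y" "u \<notin> g ` fst X" by auto
      have "u \<le> snd Y" using u(1) L.X_Ob by (auto simp: Ob_JointOrd)
      \<comment> \<open>The edge between these consecutive joints lies in one bead, but its image
        would cross the joint \<open>u\<close>.\<close>
      then obtain s t where "s \<in> fst X" "t \<in> fst X" "s < t" "g s < u" "u < g t"
          and "\<And>r. r \<in> fst X \<Longrightarrow> r \<le> s \<or> t \<le> r"
        using next_joint[of "fst X" "snd X" g u] u(2) K.X_Ob ends by (auto simp: Ob_JointOrd)
      moreover from this have "t \<le> snd X" using K.X_Ob by (auto simp: Ob_JointOrd)
      ultimately show False using edge[of s t] u(1) by force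
    qed
  qed
qed

end

text \<open>A monotone map of chains with a left inverse is strictly increasing, so it satisfies
  \<open>i \<le> h i\<close>. Applied in both directions this forces the identity. Thus isomorphic
  objects are equal.\<close>

lemma joint_maps_inverse:
  assumes f: "f \<in> joint_maps X Y" and g: "g \<in> joint_maps Y X"
    and X: "X \<in> Ob JointOrd" and Y: "Y \<in> Ob JointOrd"
    and gf: "\<And>i. i \<le> snd X \<Longrightarrow> g (f i) = i" and fg: "\<And>j. j \<le> snd Y \<Longrightarrow> f (g j) = j"
  shows "X = Y" "\<And>i. i \<le> snd X \<Longrightarrow> f i = i"
proof -
  have increasing: "i \<le> h i" if h: "h \<in> joint_maps U V" "\<And>i. i \<le> snd U \<Longrightarrow> k (h i) = i" and "i \<le> snd U"
    for i U V h and k :: "nat \<Rightarrow> nat"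
    using that(3)
  proof (induction i)
    case (Suc i)
    then have "h i \<le> h (Suc i)" "h i \<noteq> h (Suc i)" "i \<le> h i"
      using joint_maps_mono[OF h(1), of i "Suc i"] h(2)[of i] h(2)[of "Suc i"] by auto
    then show ?case by linarith
  qed simp
  show id: "f i = i" if "i \<le> snd X" for i
    using increasing[OF f gf that] increasing[OF g fg, of "f i"] joint_maps_le[OF f that] gf[OF that]
    by simp
  have id': "g j = j" if "j \<le> snd Y" for j
    using increasing[OF g fg that] increasing[OF f gf, of "g j"] joint_maps_le[OF g that] fg[OF that]
    by simp
  have "f t = t" if "t \<in> fst X" for t using id[of t] that X by (auto simp: Ob_JointOrd)
  then have "f ` fst X = fst X" by (simp cong: image_cong)
  moreover have "g t = t" if "t \<in> fst Y" for t using id'[of t] that Y by (auto simp: Ob_JointOrd)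
  then have "g ` fst Y = fst Y" by (simp cong: image_cong)
  ultimately have "fst X = fst Y" using joint_mapsD(4)[OF f] joint_mapsD(4)[OF g] by auto
  moreover have "snd X = snd Y" using id[of "snd X"] joint_mapsD(3)[OF f] by simp
  ultimately show "X = Y" by (simp add: prod_eq_iff)
qed

text \<open>The identity of \<open>K\<close>, read as a map between its two labelled copies, has
  vertex maps in both directions that are mutually inverse, hence identities. This makes the choices
  in \<open>joints\<close> and \<open>label\<close> harmless.\<close>

lemma labelling_unique:
  assumes "labelling K X e" "labelling K Y d"
  shows "X = Y" "\<And>v. v \<in> simp K 0 \<Longrightarrow> e v = d v"
proof -
  interpret XY: labelled_pair K X e K Y d using assms by (simp add: labelled_pair_def)
  interpret YX: labelled_pair K Y d K X e using assms by (simp add: labelled_pair_def)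
  have id: "(\<lambda>n. \<lambda>x\<in>simp K n. x) \<in> bipointed_maps K K"
    by (rule bipointed_mapsI) (auto simp: XY.K.act_simp XY.K.src_simp XY.K.tgt_simp)
  define g where "g = (\<lambda>i\<in>{..snd X}. d (inv_into (simp K 0) e i))"
  define h where "h = (\<lambda>i\<in>{..snd Y}. e (inv_into (simp K 0) d i))"
  have g: "g (e v) = d v" and h: "h (d v) = e v" if "v \<in> simp K 0" for v
    using that by (auto simp: g_def h_def XY.K.label_le XY.L.label_le XY.K.inv_label XY.L.inv_label)
  have gj: "g \<in> joint_maps X Y" by (rule XY.joint_map_of_bipointed_map[OF id]) (simp add: g_def, simp add: g)
  have hj: "h \<in> joint_maps Y X" by (rule YX.joint_map_of_bipointed_map[OF id]) (simp add: h_def, simp add: h)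
  have hg: "h (g i) = i" if "i \<le> snd X" for i
    using XY.K.vertex_exists[OF that] g h by metis
  have gh: "g (h i) = i" if "i \<le> snd Y" for i
    using XY.L.vertex_exists[OF that] g h by metis
  have inv: "X = Y" "\<And>i. i \<le> snd X \<Longrightarrow> g i = i"
    using joint_maps_inverse[OF gj hj XY.K.X_Ob XY.L.X_Ob] hg gh by blast+
  show "X = Y" by (rule inv(1))
  show "e v = d v" if "v \<in> simp K 0" for v
    using inv(2)[OF XY.K.label_le[OF that]] g[OF that] by simp
qed

text \<open>Pulling labels back along \<open>h\<close> composes the label bijections of
  \<open>K\<close> with the bijections \<open>h n\<close>. In this way iterated wedges pass their
  labels on to all necklaces.\<close>

lemma labelling_transport:
  assumes "labelling K X e" "bipointed_simplicial_set L"
    and f: "f \<in> bipointed_maps K L" and h: "h \<in> bipointed_maps L K"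
    and hf: "\<And>n x. x \<in> simp K n \<Longrightarrow> h n (f n x) = x" and fh: "\<And>n y. y \<in> simp L n \<Longrightarrow> f n (h n y) = y"
  shows "labelling L X (\<lambda>v. e (h 0 v))"
proof -
  interpret K: labelling K X e by fact
  interpret L: bipointed_simplicial_set L by fact
  show ?thesis
  proof
    fix n
    have "bij_betw (h n) (simp L n) (simp K n)"
      by (rule bij_betw_byWitness[where f' = "f n"]) (auto simp: hf fh bipointed_mapsD(1)[OF f] bipointed_mapsD(1)[OF h])
    then have "bij_betw (vertex_labels K e n \<circ> h n) (simp L n) (bead_simplices X n)"
      using K.labels_bij by (rule bij_betw_trans)
    then show "bij_betw (vertex_labels L (\<lambda>v. e (h 0 v)) n) (simp L n) (bead_simplices X n)"
      by (rule bij_betw_cong[THEN iffD1, rotated]) (simp add: vertex_labels_bipointed_map[OF h])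
  qed (simp_all add: K.X_Ob K.label_src K.label_tgt bipointed_mapsD[OF h])
qed

text \<open>The shift lets the right labels continue the left ones. With \<open>p\<close> the label
  of the left target and 0 that of the right source, both branches give \<open>p\<close> at the
  wedge point.\<close>

definition wedge_label :: "nat \<Rightarrow> ('a cell \<Rightarrow> nat) \<Rightarrow> ('a cell \<Rightarrow> nat) \<Rightarrow> 'a cell \<Rightarrow> nat" where
  "wedge_label p e d = wedge_case e (\<lambda>y. p + d y)"

locale labelled_wedge = labelled_pair K X e L Y d
  for K :: "'a cell bisset" and X e and L :: "'a cell bisset" and Y d
begin

sublocale bipointed_pair K L by unfold_locales

lemma wedge_label:
  "wedge_label (snd X) e d (left_in K L 0 x) = e x"
  "wedge_label (snd X) e d (right_in K L 0 y) = snd X + d y"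
  using wedge_case_left_in[of e K 0 "\<lambda>y. snd X + d y" L] wedge_case_right_in[of e K 0 "\<lambda>y. snd X + d y" L]
  by (simp_all add: wedge_label_def K.degen_0 L.degen_0 K.tgt_simp L.src_simp K.label_tgt L.label_src)

lemma vertex_wedge:
  assumes "i \<le> n"
  shows "vertex (K \<or>\<^sub>w L) n i (left_in K L n x) = left_in K L 0 (vertex K n i x)"
    "vertex (K \<or>\<^sub>w L) n i (right_in K L n y) = right_in K L 0 (vertex L n i y)"
  using assms by (simp_all add: vertex_def act_wedge delta_const)

lemma vertex_labels_wedge:
  "vertex_labels (K \<or>\<^sub>w L) (wedge_label (snd X) e d) n (left_in K L n x) = vertex_labels K e n x"
  "vertex_labels (K \<or>\<^sub>w L) (wedge_label (snd X) e d) n (right_in K L n y)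
    = compose {..n} ((+) (snd X)) (vertex_labels L d n y)"
  by (auto simp: vertex_labels_def vertex_wedge wedge_label compose_def)

text \<open>As \<open>snd X\<close> is a joint, a sequence that it does not separate lies on one
  side of it, and this side names the summand. The two sides share only the sequence constant at
  \<open>snd X\<close>, which belongs to the simplex that the wedge glues.\<close>

lemma labelling_wedge: "labelling (K \<or>\<^sub>w L) (joint_wedge X Y) (wedge_label (snd X) e d)"
proof -
  let ?p = "snd X" and ?W = "K \<or>\<^sub>w L"
  let ?l = "vertex_labels ?W (wedge_label ?p e d)"
  interpret W: bipointed_simplicial_set ?W by (rule bipointed_wedge)
  \<comment> \<open>Left labels are at most \<open>?p\<close> and right ones at least
    \<open>?p\<close>, so equality makes both constant.\<close>
  have degenerate: "left_in K L n x = right_in K L n y"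
    if x: "x \<in> simp K n" and y: "y \<in> simp L n"
      and eq: "vertex_labels K e n x = compose {..n} ((+) ?p) (vertex_labels L d n y)" for n x y
  proof -
    have ends: "e (vertex K n i x) = ?p \<and> d (vertex L n i y) = 0" if "i \<le> n" for i
      using fun_cong[OF eq, of i] K.label_le[OF K.vertex_simp[OF that x]] that
      by (simp add: vertex_labels_def compose_def)
    have "x = degen K n (tgt K)"
      by (rule K.simplex_eqI[OF x K.degen_simp[OF K.tgt_simp]])
        (auto simp: vertex_labels_def ends K.vertex_degen K.tgt_simp K.label_tgt intro!: restrict_ext)
    moreover have "y = degen L n (src L)"
      by (rule L.simplex_eqI[OF y L.degen_simp[OF L.src_simp]])
        (auto simp: vertex_labels_def ends L.vertex_degen L.src_simp L.label_src intro!: restrict_ext)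
    ultimately show ?thesis using glued by simp
  qed
  have shift_inj: "vertex_labels L d n y = vertex_labels L d n y'"
    if "compose {..n} ((+) ?p) (vertex_labels L d n y) = compose {..n} ((+) ?p) (vertex_labels L d n y')"
    for n y y'
  proof (rule extensionalityI[of _ "{..n}"])
    fix i assume "i \<in> {..n}"
    then show "vertex_labels L d n y i = vertex_labels L d n y' i"
      using fun_cong[OF that, of i] by (simp add: compose_def)
  qed (auto simp: vertex_labels_def)
  show ?thesis
  proof
    show "joint_wedge X Y \<in> Ob JointOrd" by (rule joint_wedge_Ob[OF K.X_Ob L.X_Ob])
    show "wedge_label ?p e d (src ?W) = 0" by (simp add: src_wedge wedge_label K.label_src)
    show "wedge_label ?p e d (tgt ?W) = snd (joint_wedge X Y)"
      by (simp add: tgt_wedge wedge_label L.label_tgt)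
    fix n
    have "inj_on (?l n) (simp ?W n)"
    proof (rule inj_onI)
      fix w w' assume w: "w \<in> simp ?W n" and w': "w' \<in> simp ?W n" and eq: "?l n w = ?l n w'"
      show "w = w'"
        using w
      proof (cases rule: wedge_simplexE)
        case x: (left x)
        from w' show ?thesis
        proof (cases rule: wedge_simplexE)
          case (left x')
          then show ?thesis using x eq K.simplex_eqI by (simp add: vertex_labels_wedge)
        next
          case (right y)
          then show ?thesis using x eq degenerate[of x n y] by (simp add: vertex_labels_wedge)
        qed
      next
        case y: (right y)
        from w' show ?thesis
        proof (cases rule: wedge_simplexE)
          case (left x)
          then show ?thesis using y eq degenerate[of x n y] by (simp add: vertex_labels_wedge)
        next
          case (right y')
          then show ?thesis using y eq shift_inj[of n y y'] L.simplex_eqI by (simp add: vertex_labels_wedge)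
        qed
      qed
    qed
    moreover have "?l n ` simp ?W n = bead_simplices (joint_wedge X Y) n"
    proof (intro equalityI subsetI)
      fix \<theta> assume "\<theta> \<in> ?l n ` simp ?W n"
      then obtain w where w: "w \<in> simp ?W n" "\<theta> = ?l n w" by auto
      from w(1) show "\<theta> \<in> bead_simplices (joint_wedge X Y) n"
      proof (cases rule: wedge_simplexE)
        case (left x)
        then have \<theta>: "\<theta> \<in> bead_simplices X n" using w K.labels_in by (simp add: vertex_labels_wedge)
        \<comment> \<open>A left simplex ends at or below \<open>?p\<close>, so no joint shifted
          from \<open>Y\<close> separates it.\<close>
        then have "\<theta> n \<le> ?p" by (auto simp: bead_simplices_def delta_iff)
        then show ?thesis using \<theta> by (auto simp: bead_simplices_def delta_iff trans_le_add1)
      next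
        case (right y)
        then have "vertex_labels L d n y \<in> bead_simplices Y n" using L.labels_in by simp
        moreover have "t \<le> ?p" if "t \<in> fst X" for t using that K.X_Ob by (auto simp: Ob_JointOrd)
        ultimately show ?thesis using w right
          by (auto simp: bead_simplices_def delta_iff vertex_labels_wedge compose_def trans_le_add1)
      qed
    next
      fix \<theta> assume "\<theta> \<in> bead_simplices (joint_wedge X Y) n"
      then have \<theta>: "\<theta> \<in> delta n (?p + snd Y)" "\<And>t. t \<in> fst X \<Longrightarrow> t \<le> \<theta> 0 \<or> \<theta> n \<le> t"
        "\<And>u. u \<in> fst Y \<Longrightarrow> ?p + u \<le> \<theta> 0 \<or> \<theta> n \<le> ?p + u"
        by (auto simp: bead_simplices_def)
      have "?p \<in> fst X" using K.X_Ob by (simp add: Ob_JointOrd)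
      then consider "\<theta> n \<le> ?p" | "?p \<le> \<theta> 0" using \<theta>(2) by blast
      then show "\<theta> \<in> ?l n ` simp ?W n"
      proof cases
        case 1
        have "\<theta> i \<le> \<theta> n" if "i \<le> n" for i using \<theta>(1) that by (simp add: delta_iff)
        then have "\<theta> \<in> bead_simplices X n"
          using \<theta> 1 by (fastforce simp: bead_simplices_def delta_iff)
        then obtain x where "x \<in> simp K n" "vertex_labels K e n x = \<theta>" by (rule K.simplex_exists)
        then show ?thesis by (intro rev_image_eqI[of "left_in K L n x"]) (simp_all add: vertex_labels_wedge)
      next
        case 2
        have ge: "?p \<le> \<theta> i" if "i \<le> n" for i
        proof -
          have "\<theta> 0 \<le> \<theta> i" using \<theta>(1) that by (simp add: delta_iff)
          then show ?thesis using 2 by simp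
        qed
        \<comment> \<open>Truncated subtraction loses nothing here, since every entry is at least
          \<open>?p\<close> by \<open>ge\<close>.\<close>
        let ?\<zeta> = "\<lambda>i\<in>{..n}. \<theta> i - ?p"
        have "?\<zeta> \<in> delta n (snd Y)"
          using \<theta>(1) by (auto simp: delta_iff intro!: diff_le_mono)
        moreover have "u \<le> ?\<zeta> 0 \<or> ?\<zeta> n \<le> u" if "u \<in> fst Y" for u using \<theta>(3)[OF that] by auto
        ultimately have "?\<zeta> \<in> bead_simplices Y n" by (simp add: bead_simplices_def)
        then obtain y where y: "y \<in> simp L n" "vertex_labels L d n y = ?\<zeta>" by (rule L.simplex_exists)
        have "compose {..n} ((+) ?p) ?\<zeta> = \<theta>"
          using \<theta>(1) ge by (intro extensionalityI[of _ "{..n}"]) (auto simp: compose_def delta_iff)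
        then show ?thesis using y
          by (intro rev_image_eqI[of "right_in K L n y"]) (simp_all add: vertex_labels_wedge)
      qed
    qed
    ultimately show "bij_betw (?l n) (simp ?W n) (bead_simplices (joint_wedge X Y) n)"
      by (simp add: bij_betw_def)
  qed
qed

end

section \<open>Labels of simplices and of iterated wedges\<close>

lemma labelling_std_simplex: "labelling (std_simplex n) ({0, n}, n) (\<lambda>c. un_Mono c 0)"
proof -
  interpret bipointed_simplicial_set "std_simplex n :: 'a cell bisset" by (rule bipointed_std_simplex)
  show ?thesis
  proof
    fix m
    \<comment> \<open>The extreme joints 0 and \<open>n\<close> separate no sequence in the chain,
      so a simplex is a single bead.\<close>
    have beads: "bead_simplices ({0, n}, n) m = delta m n"
      by (auto simp: bead_simplices_def delta_iff)
    have labels: "vertex_labels (std_simplex n) (\<lambda>c. un_Mono c 0) m (Mono \<theta>) = \<theta>" if "\<theta> \<in> delta m n" for \<theta>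
      using that by (intro extensionalityI[of _ "{..m}"])
        (auto simp: vertex_labels_def vertex_def std_simplex_def compose_def delta_iff)
    show "bij_betw (vertex_labels (std_simplex n) (\<lambda>c. un_Mono c 0) m) (simp (std_simplex n) m)
        (bead_simplices ({0, n}, n) m)"
      unfolding beads by (rule bij_betw_byWitness[where f' = Mono])
        (auto simp: labels, auto simp: std_simplex_def labels[unfolded std_simplex_def])
  qed (auto simp: Ob_JointOrd std_simplex_def)
qed

lemma labelling_iterated_wedge:
  "\<exists>X e. labelling (iterated_wedge ns :: 'a cell bisset) X e"
proof (induction ns rule: iterated_wedge.induct)
  case (3 n m ns)
  then obtain X e where "labelling (iterated_wedge (m # ns) :: 'a cell bisset) X e" by blast
  then interpret labelled_wedge "std_simplex n :: 'a cell bisset" "({0, n}, n)" "\<lambda>c. un_Mono c 0"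
    "iterated_wedge (m # ns) :: 'a cell bisset" X e
    by (simp add: labelled_wedge_def labelled_pair_def labelling_std_simplex)
  show ?case using labelling_wedge by (auto simp del: split_paired_Ex)
qed (use labelling_std_simplex in auto)

text \<open>Split off the first bead, whose length is the least positive joint, and recurse on the
  rest. The clause \<open>ns \<noteq> []\<close> strengthens the induction: the wedge equation of
  \<open>iterated_wedge\<close> applies only to a nonempty tail.\<close>

lemma iterated_wedge_exists:
  assumes "X \<in> Ob JointOrd"
  shows "\<exists>ns e. (\<forall>n \<in> set ns. n > 0) \<and> labelling (iterated_wedge ns :: 'a cell bisset) X e
    \<and> (snd X > 0 \<longrightarrow> ns \<noteq> [])"
  using assms
proof (induction "snd X" arbitrary: X rule: less_induct)
  case less
  obtain T p where X: "X = (T, p)" by (cases X)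
  have T: "0 \<in> T" "p \<in> T" "T \<subseteq> {..p}" using less.prems by (auto simp: X Ob_JointOrd)
  show ?case
  proof (cases "p = 0")
    case True
    then have "X = ({0, 0}, 0)" using T by (auto simp: X)
    then have "labelling (iterated_wedge [] :: 'a cell bisset) X (\<lambda>c. un_Mono c 0)"
      using labelling_std_simplex[of 0] by simp
    then show ?thesis using True by (intro exI[of _ "[]"]) (auto simp: X)
  next
    case False
    define t where "t = (LEAST t. t \<in> T \<and> t > 0)"
    have t: "t \<in> T" "t > 0" and t_least: "\<And>r. r \<in> T \<Longrightarrow> r > 0 \<Longrightarrow> t \<le> r"
      unfolding t_def using LeastI[of "\<lambda>t. t \<in> T \<and> t > 0" p] Least_le[of "\<lambda>t. t \<in> T \<and> t > 0"] T False by auto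
    show ?thesis
    proof (cases "t = p")
      case True
      have "r = 0 \<or> r = p" if "r \<in> T" for r using t_least[OF that] T(3) that True by force
      then have "X = ({0, p}, p)" using T by (auto simp: X)
      then have "labelling (iterated_wedge [p] :: 'a cell bisset) X (\<lambda>c. un_Mono c 0)"
        using labelling_std_simplex[of p] by simp
      then show ?thesis using False by (intro exI[of _ "[p]"]) auto
    next
      case tp: False
      then have "t < p" using t(1) T(3) by (auto simp: le_less)
      \<comment> \<open>The joints from \<open>t\<close> on, moved down so that \<open>t\<close>
        becomes 0.\<close>
      define Y where "Y = ({u. t + u \<in> T}, p - t)"
      have Y: "Y \<in> Ob JointOrd" "snd Y < snd X" "snd Y > 0"
        using T t \<open>t < p\<close> by (auto simp: Y_def X Ob_JointOrd)
      have XY: "joint_wedge ({0, t}, t) Y = X"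
      proof -
        have "r \<in> (+) t ` {u. t + u \<in> T}" if "r \<in> T" "r \<noteq> 0" for r
          using t_least[of r] that by (intro rev_image_eqI[of "r - t"]) auto
        then show ?thesis using T t \<open>t < p\<close> by (auto simp: joint_wedge_eq X Y_def)
      qed
      obtain n ns e where ns: "\<forall>n \<in> set (n # ns). n > 0"
          and lab: "labelling (iterated_wedge (n # ns) :: 'a cell bisset) Y e"
        using less.hyps[OF Y(2,1)] Y(3) by (metis neq_Nil_conv)
      interpret labelled_wedge "std_simplex t :: 'a cell bisset" "({0, t}, t)" "\<lambda>c. un_Mono c 0"
        "iterated_wedge (n # ns) :: 'a cell bisset" Y e
        using lab by (simp add: labelled_wedge_def labelled_pair_def labelling_std_simplex)
      show ?thesis
        using labelling_wedge ns t(2) by (intro exI[of _ "t # n # ns"]) (auto simp: XY)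
    qed
  qed
qed

section \<open>The functor recording joints and vertex maps\<close>

lemma category_full_subcategory: "category C \<Longrightarrow> category (full_subcategory C P)"
  unfolding category_def full_subcategory_def by (simp split: if_splits) metis

lemma isos_full_subcategory: "P X \<Longrightarrow> P Y \<Longrightarrow> isos (full_subcategory C P) X Y = isos C X Y"
  by (simp add: isos_def full_subcategory_def)

lemma BSSet_simps:
  "Ob BSSet = Collect bipointed_simplicial_set"
  "ident BSSet K = mk_arrow K (\<lambda>n x. x) K"
  "cmp BSSet (L', \<psi>, M) (K, \<phi>, L) = mk_arrow K (\<lambda>n x. \<psi> n (\<phi> n x)) M"
  by (simp_all add: BSSet_def)

lemma Hom_BSSet:
  "h \<in> Hom BSSet K L \<longleftrightarrow> bipointed_simplicial_set K \<and> bipointed_simplicial_set L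
    \<and> (\<exists>f \<in> bipointed_maps K L. h = (K, f, L))"
  by (auto simp: BSSet_def)

lemma mk_arrow_eqI:
  assumes "f \<in> bipointed_maps K L" "\<And>n x. x \<in> simp K n \<Longrightarrow> h n x = f n x"
  shows "mk_arrow K h L = (K, f, L)"
proof -
  have "restrict (h n) (simp K n) = f n" for n
    by (rule extensionalityI[OF _ bipointed_mapsD(2)[OF assms(1)]]) (simp_all add: assms(2))
  then show ?thesis by (simp add: mk_arrow_def)
qed

lemma bipointed_maps_compose:
  assumes "bipointed_simplicial_set K" "f \<in> bipointed_maps K L" "g \<in> bipointed_maps L M"
  shows "(\<lambda>n. \<lambda>x\<in>simp K n. g n (f n x)) \<in> bipointed_maps K M"
proof -
  interpret bipointed_simplicial_set K by fact
  show ?thesis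
    by (rule bipointed_mapsI)
      (simp_all add: act_simp src_simp tgt_simp bipointed_mapsD[OF assms(2)] bipointed_mapsD[OF assms(3)])
qed

lemma category_BSSet: "category BSSet"
proof
  show "f \<in> Hom BSSet X Y \<Longrightarrow> X \<in> Ob BSSet \<and> Y \<in> Ob BSSet"
    for f :: "'a bisset_arrow" and X Y
    by (simp add: Hom_BSSet BSSet_simps)
  show "f \<in> Hom BSSet X Y \<Longrightarrow> f \<in> Hom BSSet X' Y' \<Longrightarrow> X = X' \<and> Y = Y'"
    for f :: "'a bisset_arrow" and X Y X' Y'
    by (auto simp: Hom_BSSet)
  show "ident BSSet X \<in> Hom BSSet X X" if "X \<in> Ob BSSet" for X :: "'a cell bisset"
  proof -
    interpret bipointed_simplicial_set X using that by (simp add: BSSet_simps)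
    have "(\<lambda>n. \<lambda>x\<in>simp X n. x) \<in> bipointed_maps X X"
      by (rule bipointed_mapsI) (auto simp: act_simp src_simp tgt_simp)
    then show ?thesis
      using that by (simp add: Hom_BSSet BSSet_simps mk_arrow_def)
  qed
  show "cmp BSSet g f \<in> Hom BSSet X Z" if "f \<in> Hom BSSet X Y" "g \<in> Hom BSSet Y Z"
    for f g :: "'a bisset_arrow" and X Y Z
    using that by (auto simp: Hom_BSSet BSSet_simps mk_arrow_def intro: bipointed_maps_compose)
  show "cmp BSSet (ident BSSet Y) f = f" if f: "f \<in> Hom BSSet X Y" for f :: "'a bisset_arrow" and X Y
  proof -
    obtain a where "f = (X, a, Y)" "a \<in> bipointed_maps X Y" using f by (auto simp: Hom_BSSet)
    then show ?thesis
      by (simp add: BSSet_simps(2) mk_arrow_def[of Y])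
        (simp add: BSSet_simps mk_arrow_eqI bipointed_mapsD)
  qed
  show "cmp BSSet f (ident BSSet X) = f" if f: "f \<in> Hom BSSet X Y" for f :: "'a bisset_arrow" and X Y
  proof -
    obtain a where "f = (X, a, Y)" "a \<in> bipointed_maps X Y" using f by (auto simp: Hom_BSSet)
    then show ?thesis
      by (simp add: BSSet_simps(2) mk_arrow_def[of X _ X])
        (simp add: BSSet_simps mk_arrow_eqI bipointed_mapsD)
  qed
  show "cmp BSSet (cmp BSSet h g) f = cmp BSSet h (cmp BSSet g f)"
    if "f \<in> Hom BSSet W X" "g \<in> Hom BSSet X Y" "h \<in> Hom BSSet Y Z"
    for f g h :: "'a bisset_arrow" and W X Y Z
    using that by (auto simp: Hom_BSSet BSSet_simps mk_arrow_def bipointed_mapsD fun_eq_iff restrict_def)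
qed

section \<open>Chosen joints and labels, and the functor that they define\<close>

definition labelled :: "'a cell bisset \<Rightarrow> bool" where
  "labelled K \<longleftrightarrow> (\<exists>X e. labelling K X e)"

definition joints :: "'a cell bisset \<Rightarrow> joint_object" where
  "joints K = (SOME X. \<exists>e. labelling K X e)"

text \<open>The choice shows only away from the vertices: by \<open>labelling_unique\<close> the
  joints and the labels of vertices are determined by \<open>K\<close>.\<close>

definition label :: "'a cell bisset \<Rightarrow> 'a cell \<Rightarrow> nat" where
  "label K = (SOME e. labelling K (joints K) e)"

lemma labelling_label: "labelled K \<Longrightarrow> labelling K (joints K) (label K)"
  unfolding labelled_def label_def joints_def by (metis (mono_tags, lifting) someI_ex)

lemma labelled_imp_bipointed: "labelled K \<Longrightarrow> bipointed_simplicial_set K"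
  using labelling_label labelling.axioms(1) by blast

lemma labelling_labelled:
  assumes "labelling K X e"
  shows "labelled K" "joints K = X" "v \<in> simp K 0 \<Longrightarrow> label K v = e v"
proof -
  show "labelled K" using assms unfolding labelled_def by blast
  from labelling_unique[OF labelling_label[OF this] assms]
  show "joints K = X" "v \<in> simp K 0 \<Longrightarrow> label K v = e v" by auto
qed

abbreviation vlabels :: "'a cell bisset \<Rightarrow> nat \<Rightarrow> 'a cell \<Rightarrow> nat \<Rightarrow> nat" where
  "vlabels K \<equiv> vertex_labels K (label K)"

text \<open>This is \<open>f 0\<close> conjugated by the vertex labels;
  \<open>vertex_map_label\<close> is the resulting commuting square.\<close>

definition vertex_map :: "'a cell bisset \<Rightarrow> (nat \<Rightarrow> 'a cell \<Rightarrow> 'a cell) \<Rightarrow> 'a cell bisset \<Rightarrow> nat \<Rightarrow> nat" where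
  "vertex_map K f L = (\<lambda>i\<in>{..snd (joints K)}. label L (f 0 (inv_into (simp K 0) (label K) i)))"

definition joint_functor :: "('a cell bisset, 'a bisset_arrow, joint_object, joint_arrow) functr" where
  "joint_functor = \<lparr>onOb = joints, onHom = (\<lambda>(K, f, L). (joints K, vertex_map K f L, joints L))\<rparr>"

lemma joint_functor_simps:
  "onOb joint_functor = joints"
  "onHom joint_functor (K, f, L) = (joints K, vertex_map K f L, joints L)"
  by (simp_all add: joint_functor_def)

lemma labelled_pair_labels: "labelled K \<Longrightarrow> labelled L \<Longrightarrow> labelled_pair K (joints K) (label K) L (joints L) (label L)"
  by (simp add: labelled_pair_def labelling_label)

lemma vertex_map_label:
  assumes "labelled K" "v \<in> simp K 0"
  shows "vertex_map K f L (label K v) = label L (f 0 v)"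
proof -
  interpret labelling K "joints K" "label K" using assms(1) by (rule labelling_label)
  show ?thesis using assms(2) by (simp add: vertex_map_def label_le inv_label)
qed

lemma vertex_map_eqI:
  assumes "labelled K" "g \<in> extensional {..snd (joints K)}"
    and "\<And>v. v \<in> simp K 0 \<Longrightarrow> label L (f 0 v) = g (label K v)"
  shows "vertex_map K f L = g"
proof (rule extensionalityI[OF _ assms(2)])
  interpret labelling K "joints K" "label K" using assms(1) by (rule labelling_label)
  show "vertex_map K f L \<in> extensional {..snd (joints K)}" by (simp add: vertex_map_def)
  fix i assume "i \<in> {..snd (joints K)}"
  then show "vertex_map K f L i = g i"
    using assms(3) label_inv[of i] by (auto simp: vertex_map_def)
qed

lemma vertex_map_joint_maps:
  assumes "labelled K" "labelled L" "f \<in> bipointed_maps K L"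
  shows "vertex_map K f L \<in> joint_maps (joints K) (joints L)"
proof -
  interpret labelled_pair K "joints K" "label K" L "joints L" "label L"
    using assms(1,2) by (rule labelled_pair_labels)
  show ?thesis
    by (rule joint_map_of_bipointed_map[OF assms(3)])
      (simp add: vertex_map_def, simp add: vertex_map_label[OF assms(1)])
qed

lemma Hom_labelled:
  "h \<in> Hom (full_subcategory BSSet labelled) K L \<longleftrightarrow>
    labelled K \<and> labelled L \<and> (\<exists>f \<in> bipointed_maps K L. h = (K, f, L))"
  using labelled_imp_bipointed by (auto simp: full_subcategory_def Hom_BSSet)

lemma labelled_simps:
  "Ob (full_subcategory BSSet labelled) = Collect labelled"
  "ident (full_subcategory BSSet labelled) = ident BSSet"
  "cmp (full_subcategory BSSet labelled) = cmp BSSet"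
  using labelled_imp_bipointed by (auto simp: full_subcategory_def BSSet_simps)

lemma fully_faithful_joint_functor:
  "fully_faithful_functor (full_subcategory BSSet labelled) JointOrd
    (joint_functor :: ('a cell bisset, 'a bisset_arrow, joint_object, joint_arrow) functr)"
proof -
  interpret C: category "full_subcategory BSSet labelled :: ('a cell bisset, 'a bisset_arrow) moncat"
    by (rule category_full_subcategory[OF category_BSSet])
  interpret D: category JointOrd by (rule category_JointOrd)
  have Ob: "joints K \<in> Ob JointOrd" if "labelled K" for K :: "'a cell bisset"
    using labelling_label[OF that] by (rule labelling.X_Ob)
  show ?thesis
  proof (unfold_locales, goal_cases)
    case (1 h K L)
    then show ?case
      by (auto simp: Hom_labelled Hom_JointOrd joint_functor_simps Ob vertex_map_joint_maps)
  next
    case (2 K)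
    then show ?case by (simp add: labelled_simps joint_functor_simps Ob)
  next
    case (3 K)
    then have "vertex_map K (\<lambda>n. \<lambda>x\<in>simp K n. x) K = (\<lambda>i\<in>{..snd (joints K)}. i)"
      by (intro vertex_map_eqI) (auto simp: labelled_simps labelling.label_le[OF labelling_label])
    then show ?case
      by (simp add: labelled_simps BSSet_simps mk_arrow_def joint_functor_simps JointOrd_simps joint_ident_def)
  next
    case (4 f K L g M)
    then obtain a b where ab: "f = (K, a, L)" "g = (L, b, M)" "a \<in> bipointed_maps K L" "b \<in> bipointed_maps L M"
      and lab: "labelled K" "labelled L" "labelled M" by (auto simp: Hom_labelled)
    have "vertex_map K (\<lambda>n. \<lambda>x\<in>simp K n. b n (a n x)) M
        = compose {..snd (joints K)} (vertex_map L b M) (vertex_map K a L)"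
      by (rule vertex_map_eqI[OF lab(1)])
        (auto simp: compose_def labelling.label_le[OF labelling_label] lab vertex_map_label
          bipointed_mapsD[OF ab(3)])
    then show ?case
      by (simp add: ab labelled_simps BSSet_simps mk_arrow_def joint_functor_simps JointOrd_simps)
  next
    case (5 K L h)
    then have lab: "labelled K" "labelled L" by (auto simp: labelled_simps)
    interpret labelled_pair K "joints K" "label K" L "joints L" "label L"
      using lab by (rule labelled_pair_labels)
    obtain g where g: "h = (joints K, g, joints L)" "g \<in> joint_maps (joints K) (joints L)"
      using 5(3) by (auto simp: Hom_JointOrd joint_functor_simps)
    obtain f where f: "f \<in> bipointed_maps K L" "\<And>v. v \<in> simp K 0 \<Longrightarrow> label L (f 0 v) = g (label K v)"
      using bipointed_map_exists[OF g(2)] by blast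
    have "vertex_map K f L = g"
      using joint_mapsD(1)[OF g(2)] f(2) lab by (intro vertex_map_eqI) (auto simp: delta_iff)
    then show ?case
      using f(1) lab g(1) by (intro bexI[of _ "(K, f, L)"]) (auto simp: Hom_labelled joint_functor_simps)
  next
    case (6 f K L f')
    then obtain a a' where a: "f = (K, a, L)" "f' = (K, a', L)" "a \<in> bipointed_maps K L" "a' \<in> bipointed_maps K L"
      and lab: "labelled K" "labelled L" by (auto simp: Hom_labelled)
    interpret labelled_pair K "joints K" "label K" L "joints L" "label L"
      using lab by (rule labelled_pair_labels)
    have "vertex_map K a L = vertex_map K a' L" using 6(3) by (simp add: a joint_functor_simps)
    then have "a = a'"
      using vertex_map_label[OF lab(1), of _ _ L] by (intro bipointed_map_eqI[OF a(3,4)]) metis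
    then show ?case by (simp add: a)
  qed
qed

text \<open>A necklace inherits the labels of an isomorphic iterated wedge. Conversely, some
  iterated wedge has the same joints as \<open>K\<close>; the identity of these joints lifts by
  fullness to an arrow, which is invertible because isomorphisms are reflected.\<close>

lemma necklace_eq_labelled: "necklace = (labelled :: 'a cell bisset \<Rightarrow> bool)"
proof (intro ext iffI)
  fix K :: "'a cell bisset"
  assume "necklace K"
  then obtain ns h where h: "h \<in> isos BSSet (iterated_wedge ns) K" by (auto simp: necklace_def)
  let ?I = "iterated_wedge ns :: 'a cell bisset"
  obtain X e where e: "labelling ?I X e" using labelling_iterated_wedge by blast
  obtain k where "h \<in> Hom BSSet ?I K" "k \<in> Hom BSSet K ?I"
      and inv: "cmp BSSet k h = ident BSSet ?I" "cmp BSSet h k = ident BSSet K"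
    using h by (auto simp: isos_def)
  then obtain f g where fg: "h = (?I, f, K)" "k = (K, g, ?I)" "f \<in> bipointed_maps ?I K" "g \<in> bipointed_maps K ?I"
    and K: "bipointed_simplicial_set K" by (auto simp: Hom_BSSet)
  have "g n (f n x) = x" if "x \<in> simp ?I n" for n x
    using inv(1) that by (simp add: fg BSSet_simps mk_arrow_def fun_eq_iff restrict_def) metis
  moreover have "f n (g n x) = x" if "x \<in> simp K n" for n x
    using inv(2) that by (simp add: fg BSSet_simps mk_arrow_def fun_eq_iff restrict_def) metis
  ultimately show "labelled K"
    unfolding labelled_def using labelling_transport[OF e K fg(3,4)] by blast
next
  fix K :: "'a cell bisset"
  assume K: "labelled K"
  interpret fully_faithful_functor "full_subcategory BSSet labelled :: ('a cell bisset, 'a bisset_arrow) moncat"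
    JointOrd joint_functor by (rule fully_faithful_joint_functor)
  have X: "joints K \<in> Ob JointOrd" using onOb_Ob[of K] K by (simp add: labelled_simps joint_functor_simps)
  obtain ns e where ns: "\<forall>n \<in> set ns. n > 0" and e: "labelling (iterated_wedge ns :: 'a cell bisset) (joints K) e"
    using iterated_wedge_exists[OF X] by blast
  let ?I = "iterated_wedge ns :: 'a cell bisset"
  have I: "labelled ?I" "joints ?I = joints K" using labelling_labelled[OF e] by auto
  then obtain f where f: "f \<in> Hom (full_subcategory BSSet labelled) ?I K" "onHom joint_functor f = ident JointOrd (joints K)"
    using full[of ?I K "ident JointOrd (joints K)"] K D.ident_Hom[OF X]
    by (auto simp: labelled_simps joint_functor_simps)
  have "f \<in> isos (full_subcategory BSSet labelled) ?I K"
    by (rule reflects_isos[OF f(1)]) (simp add: f(2) joint_functor_simps I D.ident_iso[OF X])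
  then show "necklace K"
    unfolding necklace_def using ns isos_full_subcategory[of labelled ?I K BSSet] I K by auto
qed

lemma Nec_eq: "Nec = full_subcategory BSSet labelled"
  by (simp add: Nec_def necklace_eq_labelled)

lemma joint_functor_surjective:
  assumes "X \<in> Ob JointOrd"
  obtains K :: "'a cell bisset" where "labelled K" "joints K = X"
  using iterated_wedge_exists[OF assms] labelling_labelled that by blast

section \<open>Wedges, tensor maps and structure maps in terms of labels\<close>

lemma vlabels_le:
  assumes "labelled K" "x \<in> simp K n" "i \<le> n"
  shows "vlabels K n x i \<le> snd (joints K)"
proof -
  interpret labelling K "joints K" "label K" using assms(1) by (rule labelling_label)
  show ?thesis using assms(2,3) by (simp add: vertex_labels_def label_le vertex_simp)
qed

lemma vlabels_map:
  assumes "labelled K" "labelled L" "f \<in> bipointed_maps K L" "x \<in> simp K n" "i \<le> n"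
  shows "vlabels L n (f n x) i = vertex_map K f L (vlabels K n x i)"
proof -
  interpret labelled_pair K "joints K" "label K" L "joints L" "label L"
    using assms(1,2) by (rule labelled_pair_labels)
  show ?thesis
    using labels_map[of f "vertex_map K f L", OF assms(3) vertex_map_label[OF assms(1), symmetric] assms(4)] assms(5)
    by (simp add: compose_def)
qed

lemma vlabels_degen:
  assumes "labelled K" "v \<in> simp K 0" "i \<le> n"
  shows "vlabels K n (degen K n v) i = label K v"
proof -
  interpret labelling K "joints K" "label K" using assms(1) by (rule labelling_label)
  show ?thesis using assms(2,3) by (simp add: vertex_labels_def vertex_degen)
qed

text \<open>Reduces a map given by a formula to two checks, on simplices and on labels. It yields
  the arrow together with its image under the functor, and serves the tensor maps and all structure
  maps.\<close>

lemma arrowI: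
  assumes lab: "labelled K" "labelled L" and g: "g \<in> joint_maps (joints K) (joints L)"
    and simp: "\<And>n x. x \<in> simp K n \<Longrightarrow> f n x \<in> simp L n"
    and labels: "\<And>n x i. x \<in> simp K n \<Longrightarrow> i \<le> n \<Longrightarrow> vlabels L n (f n x) i = g (vlabels K n x i)"
  shows "mk_arrow K f L \<in> Hom Nec K L" "onHom joint_functor (mk_arrow K f L) = (joints K, g, joints L)"
proof -
  interpret labelled_pair K "joints K" "label K" L "joints L" "label L"
    using lab by (rule labelled_pair_labels)
  let ?f = "\<lambda>n. restrict (f n) (simp K n)"
  have "vlabels L n (?f n x) = compose {..n} g (vlabels K n x)" if "x \<in> simp K n" for n x
    by (rule extensionalityI[of _ "{..n}"]) (use labels[OF that] that in \<open>auto simp: compose_def vertex_labels_def\<close>)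
  note map = bipointed_mapI[OF g, of ?f, OF _ _ this]
  have "?f \<in> bipointed_maps K L" by (rule map(1)) (auto simp: simp)
  then show "mk_arrow K f L \<in> Hom Nec K L" using lab by (simp add: Nec_eq Hom_labelled mk_arrow_def)
  have "vertex_map K ?f L = g"
    by (rule vertex_map_eqI[OF lab(1)])
      (use joint_mapsD(1)[OF g] map(2) in \<open>auto simp: delta_iff simp\<close>)
  then show "onHom joint_functor (mk_arrow K f L) = (joints K, g, joints L)"
    by (simp add: mk_arrow_def joint_functor_simps)
qed

lemma labelled_wedge_labels:
  "labelled K \<Longrightarrow> labelled L \<Longrightarrow> labelled_wedge K (joints K) (label K) L (joints L) (label L)"
  by (simp add: labelled_wedge_def labelled_pair_labels)

lemma bipointed_pair_labelled: "labelled K \<Longrightarrow> labelled L \<Longrightarrow> bipointed_pair K L"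
  by (simp add: bipointed_pair_def labelled_imp_bipointed)

lemma wedge_labelled:
  assumes "labelled K" "labelled L"
  shows "labelled (K \<or>\<^sub>w L)" "joints (K \<or>\<^sub>w L) = joint_wedge (joints K) (joints L)"
    and "x \<in> simp K n \<Longrightarrow> i \<le> n \<Longrightarrow> vlabels (K \<or>\<^sub>w L) n (left_in K L n x) i = vlabels K n x i"
    and "y \<in> simp L n \<Longrightarrow> i \<le> n
      \<Longrightarrow> vlabels (K \<or>\<^sub>w L) n (right_in K L n y) i = snd (joints K) + vlabels L n y i"
proof -
  interpret labelled_wedge K "joints K" "label K" L "joints L" "label L"
    using assms by (rule labelled_wedge_labels)
  interpret W: bipointed_simplicial_set "K \<or>\<^sub>w L" by (rule bipointed_wedge)
  note lab = labelling_labelled[OF labelling_wedge]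
  show "labelled (K \<or>\<^sub>w L)" "joints (K \<or>\<^sub>w L) = joint_wedge (joints K) (joints L)" by (fact lab)+
  note eq = W.vertex_labels_cong[OF lab(3)]
  show "vlabels (K \<or>\<^sub>w L) n (left_in K L n x) i = vlabels K n x i" if "x \<in> simp K n" "i \<le> n"
    using that eq[OF _ left_in_simp[OF that(1)]] by (simp add: vertex_labels_wedge)
  show "vlabels (K \<or>\<^sub>w L) n (right_in K L n y) i = snd (joints K) + vlabels L n y i"
    if "y \<in> simp L n" "i \<le> n"
    using that eq[OF _ right_in_simp[OF that(1)]] by (simp add: vertex_labels_wedge compose_def)
qed

lemma (in bipointed_pair) degen_wedge:
  "degen (K \<or>\<^sub>w L) n (left_in K L 0 v) = left_in K L n (degen K n v)"
  "degen (K \<or>\<^sub>w L) n (right_in K L 0 w) = right_in K L n (degen L n w)"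
  by (simp_all add: degen_def act_wedge delta_const)

lemma (in bipointed_simplicial_set) degen_map:
  "f \<in> bipointed_maps K L \<Longrightarrow> v \<in> simp K 0 \<Longrightarrow> f n (degen K n v) = degen L n (f 0 v)"
  unfolding degen_def by (rule bipointed_mapsD(3)[OF _ delta_const]) auto

lemma tensor_arrow:
  assumes lab: "labelled K" "labelled L" "labelled K'" "labelled L'"
    and f: "f \<in> bipointed_maps K K'" and g: "g \<in> bipointed_maps L L'"
  shows "tensor_map BSSet (K, f, K') (L, g, L') \<in> Hom Nec (K \<or>\<^sub>w L) (K' \<or>\<^sub>w L')"
    "onHom joint_functor (tensor_map BSSet (K, f, K') (L, g, L'))
      = tensor_map JointOrd (onHom joint_functor (K, f, K')) (onHom joint_functor (L, g, L'))"
proof -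
  interpret P: bipointed_pair K L using lab by (simp add: bipointed_pair_labelled)
  interpret P': bipointed_pair K' L' using lab by (simp add: bipointed_pair_labelled)
  let ?h = "\<lambda>n. wedge_case (\<lambda>x. left_in K' L' n (f n x)) (\<lambda>y. right_in K' L' n (g n y))"
  let ?a = "vertex_map K f K'" and ?b = "vertex_map L g L'"
  note a = vertex_map_joint_maps[OF lab(1,3) f] and b = vertex_map_joint_maps[OF lab(2,4) g]
  let ?j = "join_map (snd (joints K)) (snd (joints K')) ?a (snd (joints L)) ?b"
  \<comment> \<open>The target is preserved by \<open>f\<close> and the source by \<open>g\<close>,
    so the branches agree on the glued simplices.\<close>
  have glue: "left_in K' L' n (f n (degen K n (tgt K))) = right_in K' L' n (g n (degen L n (src L)))" for n
    by (simp add: P.K.degen_map[OF f] P.L.degen_map[OF g] P.K.tgt_simp P.L.src_simp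
        bipointed_mapsD[OF f] bipointed_mapsD[OF g] P'.glued)
  have h_left: "?h n (left_in K L n x) = left_in K' L' n (f n x)" for n x
    by (rule wedge_case_left_in) (rule glue)
  have h_right: "?h n (right_in K L n y) = right_in K' L' n (g n y)" for n y
    by (rule wedge_case_right_in) (rule glue)
  note W = wedge_labelled[OF lab(1,2)] and W' = wedge_labelled[OF lab(3,4)]
  have Ob: "joints K \<in> Ob JointOrd" "joints L \<in> Ob JointOrd"
    using lab(1,2) labelling.X_Ob labelling_label by blast+
  have j: "?j \<in> joint_maps (joints (K \<or>\<^sub>w L)) (joints (K' \<or>\<^sub>w L'))"
    unfolding W(2) W'(2) by (rule join_map_joint_maps[OF a b Ob])
  have simp: "?h n w \<in> simp (K' \<or>\<^sub>w L') n" if "w \<in> simp (K \<or>\<^sub>w L) n" for n w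
    using that by (cases rule: wedge_simplexE)
      (simp_all add: h_left h_right bipointed_mapsD[OF f] bipointed_mapsD[OF g])
  have labels: "vlabels (K' \<or>\<^sub>w L') n (?h n w) i = ?j (vlabels (K \<or>\<^sub>w L) n w i)"
    if "w \<in> simp (K \<or>\<^sub>w L) n" "i \<le> n" for n w i
    using that(1)
  proof (cases rule: wedge_simplexE)
    case (left x)
    then show ?thesis using that(2)
      by (simp add: h_left W W' bipointed_mapsD[OF f] vlabels_map[OF lab(1,3) f] join_map_left vlabels_le lab)
  next
    case (right y)
    then show ?thesis using that(2)
      by (simp add: h_right W W' bipointed_mapsD[OF g] vlabels_map[OF lab(2,4) g]
          join_map_right[OF a b] vlabels_le lab)
  qed
  have eq: "tensor_map BSSet (K, f, K') (L, g, L') = mk_arrow (K \<or>\<^sub>w L) ?h (K' \<or>\<^sub>w L')"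
    by (simp add: BSSet_def)
  note arrow = arrowI[OF W(1) W'(1) j simp labels]
  show "tensor_map BSSet (K, f, K') (L, g, L') \<in> Hom Nec (K \<or>\<^sub>w L) (K' \<or>\<^sub>w L')"
    unfolding eq by (rule arrow(1))
  show "onHom joint_functor (tensor_map BSSet (K, f, K') (L, g, L'))
      = tensor_map JointOrd (onHom joint_functor (K, f, K')) (onHom joint_functor (L, g, L'))"
    unfolding eq by (rule arrow(2)[THEN trans]) (simp_all add: joint_functor_simps JointOrd_simps W(2) W'(2))
qed

text \<open>Associators and unitors leave all labels unchanged, so the functor turns them into
  identities.\<close>

lemma label_preserving_arrow:
  assumes lab: "labelled K" "labelled L" and joints: "joints K = joints L"
    and simp: "\<And>n x. x \<in> simp K n \<Longrightarrow> f n x \<in> simp L n"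
    and labels: "\<And>n x i. x \<in> simp K n \<Longrightarrow> i \<le> n \<Longrightarrow> vlabels L n (f n x) i = vlabels K n x i"
  shows "mk_arrow K f L \<in> Hom Nec K L" "onHom joint_functor (mk_arrow K f L) = joint_ident (joints L)"
proof -
  have "joints L \<in> Ob JointOrd" using lab(2) labelling.X_Ob labelling_label by blast
  then have g: "(\<lambda>i\<in>{..snd (joints K)}. i) \<in> joint_maps (joints K) (joints L)"
    by (simp add: joints joint_maps_ident)
  have "vlabels L n (f n x) i = (\<lambda>i\<in>{..snd (joints K)}. i) (vlabels K n x i)"
    if "x \<in> simp K n" "i \<le> n" for n x i
    using labels[OF that] vlabels_le[OF lab(1) that] by simp
  note arrow = arrowI[OF lab g simp this]
  show "mk_arrow K f L \<in> Hom Nec K L" by (rule arrow(1))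
  show "onHom joint_functor (mk_arrow K f L) = joint_ident (joints L)"
    by (rule arrow(2)[THEN trans]) (simp_all add: joint_ident_def joints restrict_def)
qed

lemma assoc_arrow:
  assumes lab: "labelled K" "labelled L" "labelled M"
  shows "assoc BSSet K L M \<in> Hom Nec ((K \<or>\<^sub>w L) \<or>\<^sub>w M) (K \<or>\<^sub>w (L \<or>\<^sub>w M))"
    "onHom joint_functor (assoc BSSet K L M) = assoc JointOrd (joints K) (joints L) (joints M)"
proof -
  note KL = wedge_labelled[OF lab(1,2)] and LM = wedge_labelled[OF lab(2,3)]
  note W = wedge_labelled[OF KL(1) lab(3)] and W' = wedge_labelled[OF lab(1) LM(1)]
  interpret P: bipointed_pair K L using lab by (simp add: bipointed_pair_labelled)
  interpret Q: bipointed_pair L M using lab by (simp add: bipointed_pair_labelled)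
  interpret R: bipointed_pair K "L \<or>\<^sub>w M" using lab LM by (simp add: bipointed_pair_labelled)
  let ?h1 = "\<lambda>n. wedge_case (left_in K (L \<or>\<^sub>w M) n) (\<lambda>y. right_in K (L \<or>\<^sub>w M) n (left_in L M n y))"
  let ?h = "\<lambda>n. wedge_case (?h1 n) (\<lambda>z. right_in K (L \<or>\<^sub>w M) n (right_in L M n z))"
  \<comment> \<open>The triple wedge has two wedge points, and the nested case distinction must be
    consistent at each. This condition concerns the point shared by \<open>K\<close> and
    \<open>L\<close>.\<close>
  have glue1: "left_in K (L \<or>\<^sub>w M) n (degen K n (tgt K))
      = right_in K (L \<or>\<^sub>w M) n (left_in L M n (degen L n (src L)))" for n
    using R.glued by (simp add: src_wedge Q.degen_wedge)
  have left1: "?h1 n (left_in K L n x) = left_in K (L \<or>\<^sub>w M) n x" for n x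
    by (rule wedge_case_left_in) (rule glue1)
  have right1: "?h1 n (right_in K L n y) = right_in K (L \<or>\<^sub>w M) n (left_in L M n y)" for n y
    by (rule wedge_case_right_in) (rule glue1)
  \<comment> \<open>The target of \<open>K \<or>\<^sub>w L\<close> is that of \<open>L\<close>, so
    at the second wedge point \<open>?h1\<close> is evaluated in its right branch.\<close>
  have glue: "?h1 n (degen (K \<or>\<^sub>w L) n (tgt (K \<or>\<^sub>w L)))
      = right_in K (L \<or>\<^sub>w M) n (right_in L M n (degen M n (src M)))" for n
    by (simp add: tgt_wedge P.degen_wedge right1 Q.glued)
  have h_left: "?h n (left_in (K \<or>\<^sub>w L) M n v) = ?h1 n v" for n v
    by (rule wedge_case_left_in) (rule glue)
  have h_right: "?h n (right_in (K \<or>\<^sub>w L) M n z) = right_in K (L \<or>\<^sub>w M) n (right_in L M n z)" for n z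
    by (rule wedge_case_right_in) (rule glue)
  have eq: "assoc BSSet K L M = mk_arrow ((K \<or>\<^sub>w L) \<or>\<^sub>w M) ?h (K \<or>\<^sub>w (L \<or>\<^sub>w M))"
    by (simp add: BSSet_def)
  have "?h n w \<in> simp (K \<or>\<^sub>w (L \<or>\<^sub>w M)) n \<and>
      (\<forall>i\<le>n. vlabels (K \<or>\<^sub>w (L \<or>\<^sub>w M)) n (?h n w) i = vlabels ((K \<or>\<^sub>w L) \<or>\<^sub>w M) n w i)"
    if "w \<in> simp ((K \<or>\<^sub>w L) \<or>\<^sub>w M) n" for n w
    using that
  proof (cases rule: wedge_simplexE)
    case v: (left v)
    from v(1) show ?thesis
      by (cases rule: wedge_simplexE) (simp_all add: v h_left left1 right1 KL LM W W')
  next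
    case (right z)
    then show ?thesis by (simp add: h_right KL LM W W' add.assoc)
  qed
  then have "\<And>n w. w \<in> simp ((K \<or>\<^sub>w L) \<or>\<^sub>w M) n \<Longrightarrow> ?h n w \<in> simp (K \<or>\<^sub>w (L \<or>\<^sub>w M)) n"
    "\<And>n w i. w \<in> simp ((K \<or>\<^sub>w L) \<or>\<^sub>w M) n \<Longrightarrow> i \<le> n
      \<Longrightarrow> vlabels (K \<or>\<^sub>w (L \<or>\<^sub>w M)) n (?h n w) i = vlabels ((K \<or>\<^sub>w L) \<or>\<^sub>w M) n w i"
    by blast+
  note arrow = label_preserving_arrow[OF W(1) W'(1) _ this]
  show "assoc BSSet K L M \<in> Hom Nec ((K \<or>\<^sub>w L) \<or>\<^sub>w M) (K \<or>\<^sub>w (L \<or>\<^sub>w M))"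
    unfolding eq by (rule arrow(1)) (simp add: KL(2) LM(2) W(2) W'(2) joint_wedge_assoc)
  have "onHom joint_functor (assoc BSSet K L M) = joint_ident (joints (K \<or>\<^sub>w (L \<or>\<^sub>w M)))"
    unfolding eq by (rule arrow(2)) (simp add: KL(2) LM(2) W(2) W'(2) joint_wedge_assoc)
  then show "onHom joint_functor (assoc BSSet K L M) = assoc JointOrd (joints K) (joints L) (joints M)"
    by (simp add: JointOrd_simps W'(2) LM(2))
qed

lemma unit_labelled:
  "labelled (std_simplex 0 :: 'a cell bisset)" "joints (std_simplex 0 :: 'a cell bisset) = ({0}, 0)"
  using labelling_labelled(1,2)[OF labelling_std_simplex[of 0]] by simp_all

lemma vlabels_unit:
  assumes "x \<in> simp (std_simplex 0 :: 'a cell bisset) n" "i \<le> n"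
  shows "vlabels (std_simplex 0) n x i = 0"
  using vlabels_le[OF unit_labelled(1) assms] by (simp add: unit_labelled)

lemma lunit_arrow:
  assumes K: "labelled K"
  shows "lunit BSSet K \<in> Hom Nec (std_simplex 0 \<or>\<^sub>w K) K"
    "onHom joint_functor (lunit BSSet K) = lunit JointOrd (joints K)"
proof -
  interpret labelling K "joints K" "label K" using K by (rule labelling_label)
  note W = wedge_labelled[OF unit_labelled(1) K]
  let ?h = "\<lambda>n. wedge_case (\<lambda>_. degen K n (src K)) (\<lambda>y. y)"
  \<comment> \<open>The branch for \<open>\<Delta>\<^sup>0\<close> is constant, with the value that
    the other branch takes at the glued simplex, so consistency is immediate.\<close>
  have h_left: "?h n (left_in (std_simplex 0) K n x) = degen K n (src K)" for n x
    by (rule wedge_case_left_in) simp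
  have h_right: "?h n (right_in (std_simplex 0) K n y) = y" for n y
    by (rule wedge_case_right_in) simp
  have eq: "lunit BSSet K = mk_arrow (std_simplex 0 \<or>\<^sub>w K) ?h K"
    by (simp add: BSSet_def)
  have simp: "?h n w \<in> simp K n" if "w \<in> simp (std_simplex 0 \<or>\<^sub>w K) n" for n w
    using that by (cases rule: wedge_simplexE) (simp_all add: h_left h_right degen_simp src_simp)
  have labels: "vlabels K n (?h n w) i = vlabels (std_simplex 0 \<or>\<^sub>w K) n w i"
    if "w \<in> simp (std_simplex 0 \<or>\<^sub>w K) n" "i \<le> n" for n w i
    using that(1) by (cases rule: wedge_simplexE)
      (simp_all add: that(2) h_left h_right W vlabels_degen K src_simp label_src vlabels_unit unit_labelled)
  have joints: "joints (std_simplex 0 \<or>\<^sub>w K) = joints K"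
    by (simp add: W(2) unit_labelled joint_wedge_unit_left X_Ob)
  note arrow = label_preserving_arrow[OF W(1) K joints simp labels]
  show "lunit BSSet K \<in> Hom Nec (std_simplex 0 \<or>\<^sub>w K) K" unfolding eq by (rule arrow(1))
  show "onHom joint_functor (lunit BSSet K) = lunit JointOrd (joints K)"
    unfolding eq by (rule arrow(2)[THEN trans]) (simp_all add: JointOrd_simps)
qed

lemma runit_arrow:
  assumes K: "labelled K"
  shows "runit BSSet K \<in> Hom Nec (K \<or>\<^sub>w std_simplex 0) K"
    "onHom joint_functor (runit BSSet K) = runit JointOrd (joints K)"
proof -
  interpret labelling K "joints K" "label K" using K by (rule labelling_label)
  note W = wedge_labelled[OF K unit_labelled(1)]
  let ?h = "\<lambda>n. wedge_case (\<lambda>x. x) (\<lambda>_. degen K n (tgt K))"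
  have h_left: "?h n (left_in K (std_simplex 0) n x) = x" for n x
    by (rule wedge_case_left_in) simp
  have h_right: "?h n (right_in K (std_simplex 0) n y) = degen K n (tgt K)" for n y
    by (rule wedge_case_right_in) simp
  have eq: "runit BSSet K = mk_arrow (K \<or>\<^sub>w std_simplex 0) ?h K"
    by (simp add: BSSet_def)
  have simp: "?h n w \<in> simp K n" if "w \<in> simp (K \<or>\<^sub>w std_simplex 0) n" for n w
    using that by (cases rule: wedge_simplexE) (simp_all add: h_left h_right degen_simp tgt_simp)
  have labels: "vlabels K n (?h n w) i = vlabels (K \<or>\<^sub>w std_simplex 0) n w i"
    if "w \<in> simp (K \<or>\<^sub>w std_simplex 0) n" "i \<le> n" for n w i
    using that(1) by (cases rule: wedge_simplexE)
      (simp_all add: that(2) h_left h_right W vlabels_degen K tgt_simp label_tgt vlabels_unit unit_labelled)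
  have joints: "joints (K \<or>\<^sub>w std_simplex 0) = joints K"
    by (simp add: W(2) unit_labelled joint_wedge_unit_right X_Ob)
  note arrow = label_preserving_arrow[OF W(1) K joints simp labels]
  show "runit BSSet K \<in> Hom Nec (K \<or>\<^sub>w std_simplex 0) K" unfolding eq by (rule arrow(1))
  show "onHom joint_functor (runit BSSet K) = runit JointOrd (joints K)"
    unfolding eq by (rule arrow(2)[THEN trans]) (simp_all add: JointOrd_simps)
qed

section \<open>The monoidal equivalence\<close>

lemma Nec_simps:
  "Ob Nec = Collect labelled" "tensor Nec = wedge" "tensor_map Nec = tensor_map BSSet"
  "tunit Nec = std_simplex 0" "assoc Nec = assoc BSSet" "lunit Nec = lunit BSSet"
  "runit Nec = runit BSSet"
  by (auto simp: Nec_eq labelled_simps) (simp_all add: full_subcategory_def BSSet_def)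

theorem proposition3p4:
  shows "\<exists>(F :: ('a cell bisset, 'a bisset_arrow, joint_object, joint_arrow) functr) \<phi> \<iota>.
    equivalence_of_categories Nec JointOrd F \<and> strong_monoidal_functor Nec JointOrd F \<phi> \<iota>"
proof -
  interpret fully_faithful_functor "Nec :: ('a cell bisset, 'a bisset_arrow) moncat" JointOrd joint_functor
    unfolding Nec_eq by (rule fully_faithful_joint_functor)
  interpret monoidal_category JointOrd by (rule monoidal_JointOrd)
  interpret strict_monoidal_embedding "Nec :: ('a cell bisset, 'a bisset_arrow) moncat" JointOrd joint_functor
  proof (unfold_locales, goal_cases)
    case (3 f K K' g L L')
    then obtain a b where "f = (K, a, K')" "g = (L, b, L')" "a \<in> bipointed_maps K K'" "b \<in> bipointed_maps L L'"
      "labelled K" "labelled L" "labelled K'" "labelled L'" by (auto simp: Nec_eq Hom_labelled)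
    then show ?case by (simp add: Nec_simps tensor_arrow)
  next
    case (9 f K K' g L L')
    then obtain a b where "f = (K, a, K')" "g = (L, b, L')" "a \<in> bipointed_maps K K'" "b \<in> bipointed_maps L L'"
      "labelled K" "labelled L" "labelled K'" "labelled L'" by (auto simp: Nec_eq Hom_labelled)
    then show ?case by (simp add: Nec_simps tensor_arrow)
  qed (simp_all add: Nec_simps joint_functor_simps wedge_labelled unit_labelled assoc_arrow lunit_arrow
      runit_arrow JointOrd_simps(3,5))
  have "equivalence_of_categories (Nec :: ('a cell bisset, 'a bisset_arrow) moncat) JointOrd joint_functor"
  proof (rule equivalence_if_surjective)
    fix X assume "X \<in> Ob JointOrd"
    then obtain K :: "'a cell bisset" where "labelled K" "joints K = X" by (rule joint_functor_surjective)
    then show "\<exists>K \<in> Ob (Nec :: ('a cell bisset, 'a bisset_arrow) moncat). onOb joint_functor K = X"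
      by (auto simp: Nec_simps joint_functor_simps)
  qed
  \<comment> \<open>The comparison maps are identities: \<open>joint_functor\<close> sends wedges to
    \<open>joint_wedge\<close> on the nose.\<close>
  then show ?thesis using strong_monoidal by blast
qed

end
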